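(* Given a connected chordal graph $G=([n],E)$ in perfect elimination order, Algorithm A (described in the context) visits each acyclic orientation of $G$ in time $\mathcal{O}(\log\omega)$ on average, where $\omega=\omega(G)$ is the clique number of $G$.
   Context: Graphs are finite and simple; $[n]=\{1,\ldots,n\}$. A graph is chordal if every induced cycle has length 3. $G_i$ (resp. $D_i$) denotes the subgraph (subdigraph) induced by $[i]$. $G=([n],E)$ is in perfect elimination order if for every $i\in[n]$ the neighborhood of $i$ in $G_i$ is a clique. $N_i$ denotes the set of neighbors of $i$ in $G_i$. An acyclic orientation of $G$ is an orientation of all edges of $G$ without directed cycles; an arc flip reverses the direction of a single arc. The transitive reduction of an acyclic orientation of a clique is a directed path $v_1\to v_2\to\cdots\to v_k$ (the total order given by the orientation). "On average" refers to the total time spent after the initialization step A1, divided by the number of acyclic orientations visited. Reading or writing an entry of an array or matrix takes constant time, and so does a visit. Algorithm A. Given a connected chordal graph $G=([n],E)$ in perfect elimination order, the algorithm generates all acyclic orientations of $G$ by arc flips. It maintains the current acyclic orientation $D=([n],A)$ of $G$ as an adjacency matrix $A=(a_{i,j})_{i,j\in[n]}$, with $a_{i,j}\in\{0,1\}$ and $a_{i,j}=1$ iff the arc $i\to j$ is present in $D$; total orderings $T_j=(T_{j,1},\ldots,T_{j,|N_j|})$ of $N_j$ and an index $t_j$, $0\le t_j\le|N_j|$, into $T_j$ for $j=1,\ldots,n$; and auxiliary arrays $o=(o_1,\ldots,o_n)$ with entries in $\{\mathrm{L},\mathrm{R}\}$ and $s=(s_1,\ldots,s_n)$. A1 [Initialize].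 For $i,j=1,\ldots,n$ set $a_{i,j}\gets0$. Then for $j=1,\ldots,n$ and all $i\in N_j$ set $a_{i,j}\gets1$. Also set $t_j\gets0$, $o_j\gets\mathrm{L}$, $s_j\gets j$ for $j=1,\ldots,n$. A2 [Visit]. Visit the current acyclic orientation $D$. A3 [Select vertex]. Set $j\gets s_n$, and terminate if $j=1$. A4 [Sort neighbors]. If $t_j=0$, compute the transitive reduction $v_1\to v_2\to\cdots\to v_k$ of the clique in $D_j$ formed by the vertices in $N_j$ via sorting, using the matrix entries $a_{i,i'}$, $i,i'\in N_j$, for comparisons (sorting $d$ elements takes time $\mathcal{O}(d\log d)$). If $o_j=\mathrm{L}$ set $T_j\gets(v_k,v_{k-1},\ldots,v_1)$, and if $o_j=\mathrm{R}$ set $T_j\gets(v_1,v_2,\ldots,v_k)$. A5 [Flip arc]. Set $t_j\gets t_j+1$. In $D$, flip the arc between $j$ and $i\gets T_{j,t_j}$: if $o_j=\mathrm{L}$ set $a_{i,j}\gets0$ and $a_{j,i}\gets1$; if $o_j=\mathrm{R}$ set $a_{i,j}\gets1$ and $a_{j,i}\gets0$. A6 [Update $o$ and $s$]. Set $s_n\gets n$. If $t_j=|N_j|$: if $o_j=\mathrm{L}$ ($j$ has become a source in $D_j$) set $o_j\gets\mathrm{R}$, and if $o_j=\mathrm{R}$ ($j$ has become a sink in $D_j$) set $o_j\gets\mathrm{L}$, and in both cases set $t_j\gets0$, then $s_j\gets s_{j-1}$, then $s_{j-1}\gets j-1$. Go back to A2. *)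

theory Defs
  imports Complex_Main "HOL-Library.State_Monad"
begin

section \<open>Graphs and acyclic orientations\<close>

text \<open>A simple graph on the vertex set \<open>[n] = {1..n}\<close> is given by its symmetric, irreflexive
  adjacency relation \<open>E\<close>, so an edge contributes both ordered pairs.\<close>

definition simple_graph :: "nat \<Rightarrow> (nat \<times> nat) set \<Rightarrow> bool" where
  "simple_graph n E \<longleftrightarrow> E \<subseteq> {1..n} \<times> {1..n} \<and> sym E \<and> irrefl E"

text \<open>The graph without vertices does not count as connected.\<close>

definition graph_connected :: "nat \<Rightarrow> (nat \<times> nat) set \<Rightarrow> bool" where
  "graph_connected n E \<longleftrightarrow> n \<ge> 1 \<and> (\<forall>u\<in>{1..n}. \<forall>v\<in>{1..n}. (u, v) \<in> E\<^sup>*)"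

text \<open>The vertices \<open>vs ! 0, vs ! 1, \<dots>\<close>, in this cyclic order, form a cycle of length at least 3,
  and there are no edges between them other than those of the cycle.\<close>

definition induced_cycle :: "(nat \<times> nat) set \<Rightarrow> nat list \<Rightarrow> bool" where
  "induced_cycle E vs \<longleftrightarrow> length vs \<ge> 3 \<and> distinct vs \<and>
     (\<forall>p < length vs. \<forall>q < length vs.
        (vs ! p, vs ! q) \<in> E \<longleftrightarrow> q = (p + 1) mod length vs \<or> p = (q + 1) mod length vs)"

definition chordal :: "(nat \<times> nat) set \<Rightarrow> bool" where
  "chordal E \<longleftrightarrow> (\<forall>vs. induced_cycle E vs \<longrightarrow> length vs = 3)"

definition clique :: "(nat \<times> nat) set \<Rightarrow> nat set \<Rightarrow> bool" where
  "clique E S \<longleftrightarrow> (\<forall>u\<in>S. \<forall>v\<in>S. u \<noteq> v \<longrightarrow> (u, v) \<in> E)"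

definition clique_number :: "nat \<Rightarrow> (nat \<times> nat) set \<Rightarrow> nat" where
  "clique_number n E = Max (card ` {S. S \<subseteq> {1..n} \<and> clique E S})"

text \<open>The set \<open>N\<^sub>i\<close> of neighbours of \<open>i\<close> in the subgraph induced by \<open>[i]\<close>.\<close>

definition nbrs :: "(nat \<times> nat) set \<Rightarrow> nat \<Rightarrow> nat set" where
  "nbrs E i = {h \<in> {1..i}. (h, i) \<in> E}"

definition perfect_elimination_order :: "nat \<Rightarrow> (nat \<times> nat) set \<Rightarrow> bool" where
  "perfect_elimination_order n E \<longleftrightarrow> (\<forall>i\<in>{1..n}. clique E (nbrs E i))"

text \<open>An orientation is represented by its set of arcs; it contains exactly one of the two
  ordered pairs of every edge.\<close>

definition acyclic_orientations :: "(nat \<times> nat) set \<Rightarrow> (nat \<times> nat) set set" where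
  "acyclic_orientations E = {D. D \<union> D\<inverse> = E \<and> D \<inter> D\<inverse> = {} \<and> acyclic D}"


section \<open>Machine model\<close>

datatype side = L | R

text \<open>The arrays of the algorithm: \<open>mat (i, j)\<close> is \<open>a\<^sub>i\<^sub>,\<^sub>j\<close>, \<open>ordT (j, k)\<close> is \<open>T\<^sub>j\<^sub>,\<^sub>k\<close>
  (with \<open>k\<close> counted from 1), \<open>ptr j\<close> is \<open>t\<^sub>j\<close>, \<open>dir j\<close> is \<open>o\<^sub>j\<close> and \<open>sel j\<close> is \<open>s\<^sub>j\<close>.
  The two remaining components are not accessible to the algorithm: \<open>visits\<close> is the list of
  orientations visited so far, \<open>clock\<close> the time used so far.\<close>

record config =
  mat :: "nat \<times> nat \<Rightarrow> nat"
  ordT :: "nat \<times> nat \<Rightarrow> nat"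
  ptr :: "nat \<Rightarrow> nat"
  dir :: "nat \<Rightarrow> side"
  sel :: "nat \<Rightarrow> nat"
  visits :: "(nat \<times> nat) set list"
  clock :: nat

text \<open>Each read, each write and each visit takes one unit of time. Below, \<open>charge\<close> is also
  used to account for list processing and recursive calls during sorting; all other work
  (branching, arithmetic) is at most proportional to what is charged anyway.\<close>

definition charge :: "nat \<Rightarrow> (config, unit) state" where
  "charge k = State_Monad.update (\<lambda>c. c\<lparr>clock := clock c + k\<rparr>)"

definition rd :: "(config \<Rightarrow> 'i \<Rightarrow> 'a) \<Rightarrow> 'i \<Rightarrow> (config, 'a) state" where
  "rd arr i = do {
     charge 1;
     c \<leftarrow> State_Monad.get;
     State_Monad.return (arr c i)
   }"

definition wr :: "((('i \<Rightarrow> 'a) \<Rightarrow> 'i \<Rightarrow> 'a) \<Rightarrow> config \<Rightarrow> config) \<Rightarrow> 'i \<Rightarrow> 'a \<Rightarrow> (config, unit) state"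
  where
  "wr upd i v = do {
     charge 1;
     State_Monad.update (upd (\<lambda>f. f(i := v)))
   }"

definition visit :: "nat \<Rightarrow> (config, unit) state" where
  "visit n = do {
     charge 1;
     State_Monad.update (\<lambda>c.
       c\<lparr>visits := visits c @ [{(i, j) \<in> {1..n} \<times> {1..n}. mat c (i, j) = 1}]\<rparr>)
   }"


section \<open>Sorting\<close>

text \<open>Merge sort, where \<open>x\<close> precedes \<open>y\<close> iff the matrix contains the arc from \<open>x\<close> to \<open>y\<close>. On a
  clique with acyclic orientation the result \<open>[v\<^sub>1, \<dots>, v\<^sub>k]\<close> is therefore the transitive reduction
  \<open>v\<^sub>1 \<rightarrow> \<dots> \<rightarrow> v\<^sub>k\<close>.\<close>

fun merge :: "nat list \<Rightarrow> nat list \<Rightarrow> (config, nat list) state" where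
  "merge [] ys = do { charge 1; State_Monad.return ys }"
| "merge (x # xs) [] = do { charge 1; State_Monad.return (x # xs) }"
| "merge (x # xs) (y # ys) = do {
     charge 1;
     a \<leftarrow> rd mat (x, y);
     if a = 1
     then do { zs \<leftarrow> merge xs (y # ys); State_Monad.return (x # zs) }
     else do { zs \<leftarrow> merge (x # xs) ys; State_Monad.return (y # zs) }
   }"

text \<open>The charge of \<open>length xs\<close> pays for computing the length and for splitting the list.\<close>

fun msort :: "nat list \<Rightarrow> (config, nat list) state" where
  "msort xs =
     (if length xs \<le> 1 then do { charge 1; State_Monad.return xs }
      else do {
        charge (length xs);
        ys \<leftarrow> msort (take (length xs div 2) xs);
        zs \<leftarrow> msort (drop (length xs div 2) xs);
        merge ys zs
      })"

declare msort.simps [simp del]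


section \<open>Algorithm A\<close>

text \<open>The state reached by step A1. The algorithm does not initialize the orderings \<open>T\<^sub>j\<close>. The
  clock starts at 0 only after this step.\<close>

definition initial :: "nat \<Rightarrow> (nat \<times> nat) set \<Rightarrow> config" where
  "initial n E =
     \<lparr>mat = (\<lambda>(i, j). if j \<in> {1..n} \<and> i \<in> nbrs E j then 1 else 0),
      ordT = (\<lambda>_. undefined),
      ptr = (\<lambda>_. 0),
      dir = (\<lambda>_. L),
      sel = (\<lambda>j. j),
      visits = [],
      clock = 0\<rparr>"

text \<open>Write a list into \<open>T\<^sub>j\<close> from position \<open>k\<close> upwards or downwards.\<close>

fun store_up :: "nat \<Rightarrow> nat \<Rightarrow> nat list \<Rightarrow> (config, unit) state" where
  "store_up j k [] = State_Monad.return ()"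
| "store_up j k (v # vs) = do { wr ordT_update (j, k) v; store_up j (k + 1) vs }"

fun store_down :: "nat \<Rightarrow> nat \<Rightarrow> nat list \<Rightarrow> (config, unit) state" where
  "store_down j k [] = State_Monad.return ()"
| "store_down j k (v # vs) = do { wr ordT_update (j, k) v; store_down j (k - 1) vs }"

text \<open>The adjacency lists of the input graph are available to the algorithm: looking up the number
  \<open>|N\<^sub>j|\<close> takes one unit of time, traversing the list of \<open>N\<^sub>j\<close> takes \<open>|N\<^sub>j|\<close> units.\<close>

definition nbr_count :: "(nat \<times> nat) set \<Rightarrow> nat \<Rightarrow> (config, nat) state" where
  "nbr_count E j = do { charge 1; State_Monad.return (card (nbrs E j)) }"

definition nbr_list :: "(nat \<times> nat) set \<Rightarrow> nat \<Rightarrow> (config, nat list) state" where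
  "nbr_list E j = do {
     charge (card (nbrs E j));
     State_Monad.return (sorted_list_of_set (nbrs E j))
   }"

definition stepA4 :: "(nat \<times> nat) set \<Rightarrow> nat \<Rightarrow> (config, unit) state" where
  "stepA4 E j = do {
     t \<leftarrow> rd ptr j;
     if t = 0
     then do {
       ns \<leftarrow> nbr_list E j;
       vs \<leftarrow> msort ns;
       d \<leftarrow> nbr_count E j;
       w \<leftarrow> rd dir j;
       case w of L \<Rightarrow> store_down j d vs | R \<Rightarrow> store_up j 1 vs
     }
     else State_Monad.return ()
   }"

definition stepA5 :: "nat \<Rightarrow> (config, unit) state" where
  "stepA5 j = do {
     t \<leftarrow> rd ptr j;
     wr ptr_update j (t + 1);
     t' \<leftarrow> rd ptr j;
     i \<leftarrow> rd ordT (j, t');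
     w \<leftarrow> rd dir j;
     case w of
       L \<Rightarrow> do { wr mat_update (i, j) 0; wr mat_update (j, i) 1 }
     | R \<Rightarrow> do { wr mat_update (i, j) 1; wr mat_update (j, i) 0 }
   }"

definition stepA6 :: "nat \<Rightarrow> (nat \<times> nat) set \<Rightarrow> nat \<Rightarrow> (config, unit) state" where
  "stepA6 n E j = do {
     wr sel_update n n;
     t \<leftarrow> rd ptr j;
     d \<leftarrow> nbr_count E j;
     if t = d
     then do {
       w \<leftarrow> rd dir j;
       wr dir_update j (case w of L \<Rightarrow> R | R \<Rightarrow> L);
       wr ptr_update j 0;
       i \<leftarrow> rd sel (j - 1);
       wr sel_update j i;
       wr sel_update (j - 1) (j - 1)
     }
     else State_Monad.return ()
   }"

text \<open>One round of steps A2 to A6; the result tells whether step A3 terminates the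
  algorithm.\<close>

definition one_round :: "nat \<Rightarrow> (nat \<times> nat) set \<Rightarrow> (config, bool) state" where
  "one_round n E = do {
     visit n;
     j \<leftarrow> rd sel n;
     if j = 1 then State_Monad.return True
     else do {
       stepA4 E j;
       stepA5 j;
       stepA6 n E j;
       State_Monad.return False
     }
   }"

text \<open>\<open>rounds n E c c'\<close>: started in configuration \<open>c\<close> before step A2, the algorithm terminates,
  and it does so in configuration \<open>c'\<close>.\<close>

inductive rounds :: "nat \<Rightarrow> (nat \<times> nat) set \<Rightarrow> config \<Rightarrow> config \<Rightarrow> bool" for n E where
  halt: "run_state (one_round n E) c = (True, c') \<Longrightarrow> rounds n E c c'"
| continue: "run_state (one_round n E) c = (False, c') \<Longrightarrow> rounds n E c' c'' \<Longrightarrow> rounds n E c c''"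

lemma rounds_deterministic: "rounds n E c c1 \<Longrightarrow> rounds n E c c2 \<Longrightarrow> c1 = c2"
proof (induction arbitrary: c2 rule: rounds.induct)
  case (halt c c')
  from halt.prems halt.hyps show ?case by (cases rule: rounds.cases) auto
next
  case (continue c c' c'')
  from continue.prems continue.hyps show ?case
    by (cases rule: rounds.cases) (auto intro: continue.IH)
qed

definition algorithm_A :: "nat \<Rightarrow> (nat \<times> nat) set \<Rightarrow> config \<Rightarrow> bool" where
  "algorithm_A n E c \<longleftrightarrow> rounds n E (initial n E) c"

end

theory Submission
  imports Defs "HOL-Library.Multiset"
begin

text \<open>Since \<open>N\<^sub>k\<close> is a clique, an acyclic orientation of \<open>G\<^sub>k\<^sub>-\<^sub>1\<close> orders it linearly, and the acyclic
  extensions to \<open>G\<^sub>k\<close> are obtained by declaring a final segment of that order to be the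
  out-neighbours of \<open>k\<close>; they are determined by the out-degree of \<open>k\<close>, and the algorithm sweeps
  through them by changing this degree by one at each flip. Flips keep the orientation acyclic
  because all later vertices are sources or sinks at that time. By downward induction on \<open>k\<close>, a
  run in which all vertices after \<open>k\<close> start as sources or sinks visits every acyclic orientation
  with the given restriction to \<open>[k]\<close> exactly once and then hands over to the vertex recorded in
  \<open>s\<^sub>k\<close>. For the running time, the \<open>O(d log d)\<close> sort of \<open>d = |N\<^sub>k|\<close> neighbours is charged to the
  \<open>d\<close> flips at \<open>k\<close> that follow it, and \<open>d < \<omega>\<close>.\<close>

section \<open>Acyclic orientations of chordal graphs\<close>

definition orientation :: "(nat \<times> nat) set \<Rightarrow> (nat \<times> nat) set \<Rightarrow> bool" where
  "orientation E D \<longleftrightarrow> D \<union> D\<inverse> = E \<and> D \<inter> D\<inverse> = {}"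

text \<open>For orientations this stands in for acyclicity. It is local: after a flip only triangles
  through the flipped arc need checking.\<close>

definition triangle_free :: "(nat \<times> nat) set \<Rightarrow> bool" where
  "triangle_free D \<longleftrightarrow> (\<forall>x y z. (x, y) \<in> D \<longrightarrow> (y, z) \<in> D \<longrightarrow> (z, x) \<notin> D)"

definition restr :: "(nat \<times> nat) set \<Rightarrow> nat \<Rightarrow> (nat \<times> nat) set" where
  "restr D k = D \<inter> {1..k} \<times> {1..k}"

text \<open>Reversing all arcs while \<open>o\<^sub>j = R\<close> reduces both directions of a sweep to the case \<open>L\<close>.\<close>

definition od :: "side \<Rightarrow> (nat \<times> nat) set \<Rightarrow> (nat \<times> nat) set" where
  "od w D = (case w of L \<Rightarrow> D | R \<Rightarrow> D\<inverse>)"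

definition opp :: "side \<Rightarrow> side" where
  "opp w = (case w of L \<Rightarrow> R | R \<Rightarrow> L)"

definition outs :: "(nat \<times> nat) set \<Rightarrow> nat \<Rightarrow> (nat \<times> nat) set \<Rightarrow> nat set" where
  "outs E k A = {i \<in> nbrs E k. (k, i) \<in> A}"

text \<open>The listing starts at the sink of the order induced by \<open>A\<close> on
  \<open>N_j\<close> and runs backwards: this is the order in which the vertices must become
  out-neighbours of \<open>j\<close>.\<close>

definition lists_order :: "(nat \<times> nat) set \<Rightarrow> nat \<Rightarrow> (nat \<Rightarrow> nat) \<Rightarrow> (nat \<times> nat) set \<Rightarrow> bool" where
  "lists_order E j T A \<longleftrightarrow> bij_betw T {1..card (nbrs E j)} (nbrs E j) \<and>
     (\<forall>p q. 1 \<le> p \<longrightarrow> p < q \<longrightarrow> q \<le> card (nbrs E j) \<longrightarrow> (T q, T p) \<in> A)"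

lemma od_simps [simp]: "od L D = D" "od R D = D\<inverse>" "od w (od w D) = D"
  by (auto simp: od_def split: side.splits)

lemma od_opp: "od (opp w) D = (od w D)\<inverse>"
  by (auto simp: od_def opp_def split: side.splits)

lemma orientation_od: "orientation E (od w D) \<longleftrightarrow> orientation E D"
  by (cases w) (auto simp: orientation_def)

lemma triangle_free_od: "triangle_free (od w D) \<longleftrightarrow> triangle_free D"
  by (cases w) (auto simp: triangle_free_def)

lemma restr_od: "restr (od w D) k = od w (restr D k)"
  by (cases w) (auto simp: restr_def)

locale peo_graph =
  fixes n :: nat and E :: "(nat \<times> nat) set"
  assumes simple: "simple_graph n E"
    and peo: "perfect_elimination_order n E"
    and connected: "graph_connected n E"
begin

lemma E_range: "(x, y) \<in> E \<Longrightarrow> x \<in> {1..n} \<and> y \<in> {1..n} \<and> x \<noteq> y \<and> (y, x) \<in> E"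
  using simple by (auto simp: simple_graph_def sym_def irrefl_def)

lemma E_irrefl [simp]: "(x, x) \<notin> E"
  using E_range[of x x] by auto

lemma E_sym: "(x, y) \<in> E \<Longrightarrow> (y, x) \<in> E"
  using E_range by blast

lemma nbrs_iff: "x \<in> nbrs E k \<longleftrightarrow> (x, k) \<in> E \<and> x < k"
  using E_range[of x k] by (auto simp: nbrs_def)

lemma finite_nbrs [simp]: "finite (nbrs E k)"
  by (simp add: nbrs_def)

lemma nbrs_clique: "x \<in> nbrs E k \<Longrightarrow> y \<in> nbrs E k \<Longrightarrow> x \<noteq> y \<Longrightarrow> (x, y) \<in> E"
  using peo E_range[of x k] unfolding perfect_elimination_order_def clique_def
  by (metis nbrs_iff)

section \<open>Orientations: directed triangles versus directed cycles\<close>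

lemma orientation_total: "orientation E D \<Longrightarrow> (x, y) \<in> E \<longleftrightarrow> (x, y) \<in> D \<or> (y, x) \<in> D"
  by (auto simp: orientation_def)

lemma orientation_asym: "orientation E D \<Longrightarrow> (x, y) \<in> D \<Longrightarrow> (y, x) \<notin> D"
  by (auto simp: orientation_def)

lemma orientation_E: "orientation E D \<Longrightarrow> (x, y) \<in> D \<Longrightarrow> (x, y) \<in> E"
  by (auto simp: orientation_def)

lemma orientation_tournament:
  "orientation E D \<Longrightarrow> x \<in> nbrs E k \<Longrightarrow> y \<in> nbrs E k \<Longrightarrow> x \<noteq> y \<Longrightarrow> (x, y) \<in> D \<or> (y, x) \<in> D"
  using nbrs_clique orientation_total by blast

text \<open>A passage \<open>x\<close>, \<open>Suc k\<close>, \<open>c\<close> can be bypassed: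
  \<open>x\<close> and \<open>c\<close> lie in the clique of earlier neighbours of
  \<open>Suc k\<close>, and the arc between them must be \<open>x -> c\<close> to avoid a triangle.
  A path ending in \<open>Suc k\<close> records the predecessor \<open>x\<close> for the next
  induction step.\<close>

lemma restr_path_shortcut:
  assumes D: "orientation E D" "triangle_free D"
    and path: "(a, b) \<in> (restr D (Suc k))\<^sup>+" and a: "a < Suc k"
  shows "if b = Suc k then \<exists>x. (x, Suc k) \<in> restr D (Suc k) \<and> (a, x) \<in> (restr D k)\<^sup>*
         else (a, b) \<in> (restr D k)\<^sup>+"
  using path
proof (induction rule: trancl_induct)
  case (base b)
  have "(a, b) \<in> restr D k" if "b \<noteq> Suc k"
    using base a that by (auto simp: restr_def)
  then show ?case using base by auto
next
  case (step b c)
  show ?case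
  proof (cases "b = Suc k")
    case True
    then obtain x where x: "(x, Suc k) \<in> restr D (Suc k)" "(a, x) \<in> (restr D k)\<^sup>*"
      using step.IH by auto
    have E: "(x, Suc k) \<in> E" "(Suc k, c) \<in> E" "x \<le> Suc k" "c \<le> Suc k"
      using x step.hyps True orientation_E[OF D(1)] by (auto simp: restr_def)
    have neq: "c \<noteq> Suc k" "x \<noteq> Suc k" "x \<noteq> c"
      using E x step.hyps(2) True orientation_asym[OF D(1)]
      by (auto simp: restr_def)
    then have nb: "x \<in> nbrs E (Suc k)" "c \<in> nbrs E (Suc k)"
      using E E_sym by (auto simp: nbrs_iff le_neq_implies_less)
    have "(x, c) \<in> D"
      using orientation_tournament[OF D(1) nb neq(3)] x step.hyps(2) D(2) True
      by (auto simp: triangle_free_def restr_def)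
    then have "(x, c) \<in> restr D k"
      using x(1) step.hyps(2) neq by (auto simp: restr_def)
    then show ?thesis using x(2) neq(1) by (simp add: rtrancl_into_trancl1)
  next
    case False
    then have ab: "(a, b) \<in> (restr D k)\<^sup>+" using step.IH by auto
    show ?thesis
    proof (cases "c = Suc k")
      case True
      then show ?thesis using ab step.hyps by (auto intro!: exI[of _ b])
    next
      case c: False
      then have "(b, c) \<in> restr D k" using step.hyps(2) False by (auto simp: restr_def)
      then show ?thesis using ab c by auto
    qed
  qed
qed

lemma acyclic_restr:
  assumes D: "orientation E D" "triangle_free D"
  shows "acyclic (restr D k)"
proof (induction k)
  case 0
  then show ?case by (simp add: restr_def acyclic_def)
next
  case (Suc k)
  have False if a: "(a, a) \<in> (restr D (Suc k))\<^sup>+" for a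
  proof (cases "a = Suc k")
    case False
    moreover have "a \<le> Suc k"
      using a by (auto dest!: tranclD simp: restr_def)
    ultimately show ?thesis
      using restr_path_shortcut[OF D a] Suc by (auto simp: acyclic_def split: if_splits)
  next
    case True
    \<comment> \<open>A cycle through \<open>Suc k\<close> is rotated to start at its second vertex
      \<open>y\<close>, so that \<open>restr_path_shortcut\<close> applies.\<close>
    then obtain y where y: "(a, y) \<in> restr D (Suc k)" "(y, a) \<in> (restr D (Suc k))\<^sup>*"
      using a by (auto dest: tranclD)
    have "y \<noteq> a" using y orientation_E[OF D(1)] E_range by (auto simp: restr_def)
    then have path: "(y, a) \<in> (restr D (Suc k))\<^sup>+" and lt: "y < Suc k"
      using y True by (auto simp: restr_def dest: rtranclD)
    have "(y, y) \<in> (restr D (Suc k))\<^sup>+"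
      using path y(1) by auto
    then have "(y, y) \<in> (restr D k)\<^sup>+"
      using restr_path_shortcut[OF D _ lt] lt by fastforce
    then show ?thesis using Suc by (auto simp: acyclic_def)
  qed
  then show ?case by (auto simp: acyclic_def)
qed

text \<open>In a chordal graph an orientation without directed triangles has no directed cycles at all,
  since a cycle can be shortened at its largest vertex.\<close>

lemma acyclic_orientations_iff:
  "D \<in> acyclic_orientations E \<longleftrightarrow> orientation E D \<and> triangle_free D"
proof
  assume "D \<in> acyclic_orientations E"
  then have *: "orientation E D" "acyclic D"
    by (auto simp: acyclic_orientations_def orientation_def)
  have "triangle_free D"
    unfolding triangle_free_def
  proof (intro allI impI notI)
    fix x y z assume "(x, y) \<in> D" "(y, z) \<in> D" "(z, x) \<in> D"
    then have "(x, x) \<in> D\<^sup>+" by (meson trancl.simps)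
    then show False using *(2) by (auto simp: acyclic_def)
  qed
  with * show "orientation E D \<and> triangle_free D" by simp
next
  assume D: "orientation E D \<and> triangle_free D"
  then have "restr D n = D"
    using orientation_E[of D] E_range by (fastforce simp: restr_def)
  then show "D \<in> acyclic_orientations E"
    using D acyclic_restr[of D n] by (auto simp: acyclic_orientations_def orientation_def)
qed

section \<open>Out-neighbourhoods as final segments of the order on \<open>N_k\<close>\<close>

lemma upclosed_outs:
  assumes "orientation E A" "triangle_free A" "x \<in> outs E k A" "y \<in> nbrs E k" "(x, y) \<in> A"
  shows "y \<in> outs E k A"
proof -
  \<comment> \<open>The arc \<open>y -> k\<close> would close a directed triangle with
    \<open>k -> x -> y\<close>.\<close>
  have "(y, k) \<notin> A" using assms(2,3,5) unfolding triangle_free_def outs_def by blast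
  then show ?thesis
    using assms(4) orientation_total[OF assms(1), of y k] by (auto simp: outs_def nbrs_iff)
qed

text \<open>Up-closed subsets of a tournament are nested, since an arc between two witnesses of
  incomparability would move one of them into the other set. Nested finite sets of equal size
  coincide.\<close>

lemma upclosed_eq:
  assumes A: "orientation E A"
    and U: "U \<subseteq> nbrs E k" "\<And>x y. x \<in> U \<Longrightarrow> y \<in> nbrs E k \<Longrightarrow> (x, y) \<in> A \<Longrightarrow> y \<in> U"
    and V: "V \<subseteq> nbrs E k" "\<And>x y. x \<in> V \<Longrightarrow> y \<in> nbrs E k \<Longrightarrow> (x, y) \<in> A \<Longrightarrow> y \<in> V"
    and card: "card U = card V"
  shows "U = V"
proof -
  have fin: "finite U" "finite V" using U(1) V(1) finite_nbrs finite_subset by blast+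
  have "U \<subseteq> V \<or> V \<subseteq> U"
  proof (rule ccontr)
    assume "\<not> ?thesis"
    then obtain u v where "u \<in> U" "u \<notin> V" "v \<in> V" "v \<notin> U" by blast
    moreover from this have "(u, v) \<in> A \<or> (v, u) \<in> A"
      using orientation_tournament[OF A, of u k v] U(1) V(1) by blast
    ultimately show False using U V by blast
  qed
  then show ?thesis using fin card by (metis card_subset_eq)
qed

lemma restr_eq_nbrs:
  "restr D (k - 1) = restr D' (k - 1) \<Longrightarrow> x \<in> nbrs E k \<Longrightarrow> y \<in> nbrs E k \<Longrightarrow>
     (x, y) \<in> D \<longleftrightarrow> (x, y) \<in> D'"
proof -
  assume *: "restr D (k - 1) = restr D' (k - 1)" "x \<in> nbrs E k" "y \<in> nbrs E k"
  then have "(x, y) \<in> {1..k - 1} \<times> {1..k - 1}"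
    using E_range by (fastforce simp: nbrs_iff)
  then show ?thesis using *(1) unfolding restr_def by blast
qed

lemma restr_eq_if_outs_eq:
  assumes D: "orientation E D" and D': "orientation E D'"
    and eq: "restr D (k - 1) = restr D' (k - 1)" and outs: "outs E k D = outs E k D'"
  shows "restr D k = restr D' k"
proof -
  have k: "(k, i) \<in> D \<longleftrightarrow> (k, i) \<in> D'" "(i, k) \<in> D \<longleftrightarrow> (i, k) \<in> D'" if "i < k" for i
  proof -
    show 1: "(k, i) \<in> D \<longleftrightarrow> (k, i) \<in> D'"
      using that outs orientation_E[OF D] orientation_E[OF D'] E_range
      unfolding outs_def set_eq_iff nbrs_iff by blast
    show "(i, k) \<in> D \<longleftrightarrow> (i, k) \<in> D'"
      using 1 orientation_total[OF D, of i k] orientation_total[OF D', of i k]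
        orientation_asym[OF D, of i k] orientation_asym[OF D', of i k] by blast
  qed
  have irr: "(k, k) \<notin> D" "(k, k) \<notin> D'" using orientation_E[OF D] orientation_E[OF D'] E_range by blast+
  have "(x, y) \<in> restr D k \<longleftrightarrow> (x, y) \<in> restr D' k" for x y
  proof (cases "x \<in> {1..k} \<and> y \<in> {1..k}")
    case True
    then consider "x \<in> {1..k - 1}" "y \<in> {1..k - 1}" | "x = k" "y < k" | "y = k" "x < k" | "x = k" "y = k"
      by force
    then show ?thesis
    proof cases
      case 1
      then show ?thesis using eq by (fastforce simp: restr_def)
    qed (use k irr in \<open>auto simp: restr_def\<close>)
  qed (auto simp: restr_def)
  then show ?thesis by auto
qed

text \<open>Both orientations order \<open>N_k\<close> alike, so their out-neighbourhoods are final
  segments of one order and are determined by their size.\<close>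

lemma restr_eq_if_card_outs_eq:
  assumes D: "orientation E D" "triangle_free D" and D': "orientation E D'" "triangle_free D'"
    and eq: "restr D (k - 1) = restr D' (k - 1)"
    and card: "card (outs E k (od w D)) = card (outs E k (od w D'))"
  shows "restr D k = restr D' k"
proof -
  let ?A = "od w D" and ?A' = "od w D'"
  have A: "orientation E ?A" "triangle_free ?A" "orientation E ?A'" "triangle_free ?A'"
    using D D' by (simp_all add: orientation_od triangle_free_od)
  have eqA: "restr ?A (k - 1) = restr ?A' (k - 1)" using eq by (simp add: restr_od)
  have "outs E k ?A = outs E k ?A'"
  proof (rule upclosed_eq[OF A(1)])
    show "y \<in> outs E k ?A'" if "x \<in> outs E k ?A'" "y \<in> nbrs E k" "(x, y) \<in> ?A" for x y
      using that upclosed_outs[OF A(3,4)] restr_eq_nbrs[OF eqA] by (auto simp: outs_def)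
  qed (use upclosed_outs[OF A(1,2)] card in \<open>auto simp: outs_def\<close>)
  then have "restr ?A k = restr ?A' k"
    by (rule restr_eq_if_outs_eq[OF A(1,3) eqA])
  then show ?thesis unfolding restr_od by (metis od_simps(3))
qed

text \<open>Both sides are final segments of size \<open>t\<close> of the same order, the right one
  because \<open>T\<close> starts at the sink.\<close>

lemma outs_eq_image:
  assumes A: "orientation E A" "triangle_free A" and T: "lists_order E j T A"
    and t: "card (outs E j A) = t"
  shows "outs E j A = T ` {1..t}"
proof (rule upclosed_eq[OF A(1)])
  have bij: "bij_betw T {1..card (nbrs E j)} (nbrs E j)"
    and ord: "\<And>p q. 1 \<le> p \<Longrightarrow> p < q \<Longrightarrow> q \<le> card (nbrs E j) \<Longrightarrow> (T q, T p) \<in> A"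
    using T by (auto simp: lists_order_def)
  have le: "t \<le> card (nbrs E j)" using t by (auto simp: outs_def intro: card_mono)
  show "T ` {1..t} \<subseteq> nbrs E j"
    using bij_betwE[OF bij] le by auto
  show "y \<in> T ` {1..t}" if xy: "x \<in> T ` {1..t}" "y \<in> nbrs E j" "(x, y) \<in> A" for x y
  proof -
    from xy(1) obtain p where p: "x = T p" "1 \<le> p" "p \<le> t" by auto
    have "y \<in> T ` {1..card (nbrs E j)}"
      using xy(2) bij_betw_imp_surj_on[OF bij] by blast
    then obtain q where q: "y = T q" "1 \<le> q" "q \<le> card (nbrs E j)" by auto
    have "\<not> p < q" using ord[of p q] p q orientation_asym[OF A(1) xy(3)] by auto
    then show ?thesis using p q by auto
  qed
  show "card (outs E j A) = card (T ` {1..t})"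
    using card_image[OF inj_on_subset[OF bij_betw_imp_inj_on[OF bij]], of "{1..t}"] le t by simp
  show "outs E j A \<subseteq> nbrs E j" by (auto simp: outs_def)
  show "y \<in> outs E j A" if "x \<in> outs E j A" "y \<in> nbrs E j" "(x, y) \<in> A" for x y
    using upclosed_outs[OF A that] .
qed

text \<open>A new triangle must use \<open>j -> i\<close>, hence has a third vertex \<open>y\<close>
  with \<open>i -> y -> j\<close>. If \<open>y < j\<close>, this contradicts that \<open>i\<close>
  is the sink among the remaining in-neighbours of \<open>j\<close>; if \<open>y > j\<close>, it
  contradicts that \<open>y\<close> is a source or a sink with respect to
  \<open>N_y\<close>.\<close>

lemma triangle_free_flip:
  assumes A: "orientation E A" "triangle_free A" and T: "lists_order E j T A"
    and t: "card (outs E j A) = t" "t < card (nbrs E j)" and i: "i = T (Suc t)"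
    and swept: "\<And>k. j < k \<Longrightarrow> outs E k A = {} \<or> outs E k A = nbrs E k"
    and A': "A' = A - {(i, j)} \<union> {(j, i)}"
  shows "i \<in> nbrs E j" "(i, j) \<in> A" "orientation E A'" "triangle_free A'"
    "card (outs E j A') = Suc t"
proof -
  have bij: "bij_betw T {1..card (nbrs E j)} (nbrs E j)"
    and ord: "\<And>p q. 1 \<le> p \<Longrightarrow> p < q \<Longrightarrow> q \<le> card (nbrs E j) \<Longrightarrow> (T q, T p) \<in> A"
    using T by (auto simp: lists_order_def)
  show i_nbr: "i \<in> nbrs E j" using bij_betwE[OF bij] t(2) i by auto
  have outs: "outs E j A = T ` {1..t}" using outs_eq_image[OF A T t(1)] .
  have i_out: "i \<notin> outs E j A"
    using bij_betw_imp_inj_on[OF bij] t(2) i by (auto simp: outs inj_on_eq_iff)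
  then show ij: "(i, j) \<in> A"
    using i_nbr orientation_total[OF A(1), of i j] by (auto simp: outs_def nbrs_iff)
  have neq: "i \<noteq> j" using i_nbr by (auto simp: nbrs_iff)
  show oA': "orientation E A'"
    using A(1) ij neq unfolding A' orientation_def by blast
  have "outs E j A' = insert i (outs E j A)"
    using i_nbr neq by (auto simp: A' outs_def)
  then show "card (outs E j A') = Suc t"
    using i_out t(1) by (simp add: outs_def)
  have key: False if y: "(i, y) \<in> A'" "(y, j) \<in> A'" for y
  proof -
    have yy: "(i, y) \<in> A" "(y, j) \<in> A" "y \<noteq> i" "y \<noteq> j"
      using y neq orientation_E[OF A(1)] E_range by (auto simp: A')
    show False
    proof (cases "y < j")
      case True
      then have "y \<in> nbrs E j" "y \<notin> outs E j A"
        using yy orientation_E[OF A(1)] orientation_asym[OF A(1)] by (auto simp: nbrs_iff outs_def)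
      then have y: "y \<in> T ` {1..card (nbrs E j)}" "y \<notin> T ` {1..t}"
        using bij_betw_imp_surj_on[OF bij] outs by blast+
      from y(1) obtain q where "y = T q" "1 \<le> q" "q \<le> card (nbrs E j)"
        by auto
      with y(2) have q: "y = T q" "1 \<le> q" "q \<le> card (nbrs E j)" "q \<notin> {1..t}"
        by auto
      \<comment> \<open>As an in-neighbour of \<open>j\<close> other than \<open>i\<close>, the
        vertex \<open>y\<close> is listed after \<open>i\<close>.\<close>
      then have "(T q, T (Suc t)) \<in> A" using ord[of "Suc t" q] yy(3) i by (cases "q = Suc t") auto
      then show False using yy(1) q i orientation_asym[OF A(1)] by blast
    next
      case False
      then have jy: "j < y" "i < y" using yy i_nbr by (auto simp: nbrs_iff)
      then have "i \<in> nbrs E y" "j \<in> nbrs E y"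
        using yy orientation_E[OF A(1)] E_range by (auto simp: nbrs_iff)
      moreover have "i \<notin> outs E y A" "j \<in> outs E y A"
        using yy calculation orientation_asym[OF A(1)] by (auto simp: outs_def)
      ultimately show False using swept[OF jy(1)] by auto
    qed
  qed
  show "triangle_free A'"
    unfolding triangle_free_def
  proof (intro allI impI notI)
    fix x y z assume xyz: "(x, y) \<in> A'" "(y, z) \<in> A'" "(z, x) \<in> A'"
    then consider "(x, y) = (j, i)" | "(y, z) = (j, i)" | "(z, x) = (j, i)"
      | "(x, y) \<in> A" "(y, z) \<in> A" "(z, x) \<in> A"
      unfolding A' by blast
    then show False
    proof cases
      case 1
      then show ?thesis using key[of z] xyz by simp
    next
      case 2
      then show ?thesis using key[of x] xyz by simp
    next
      case 3
      then show ?thesis using key[of y] xyz by simp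
    next
      case 4
      then show ?thesis using A(2) unfolding triangle_free_def by blast
    qed
  qed
qed

section \<open>Connectivity of the subgraphs induced by \<open>[k]\<close>\<close>

lemma restr_E_path_shortcut:
  assumes path: "(a, b) \<in> (restr E (Suc k))\<^sup>*" and a: "a < Suc k" and k: "Suc k \<le> n"
  shows "if b = Suc k then \<exists>x\<in>nbrs E (Suc k). (a, x) \<in> (restr E k)\<^sup>*
         else (a, b) \<in> (restr E k)\<^sup>*"
  using path
proof (induction rule: rtrancl_induct)
  case base
  then show ?case using a by auto
next
  case (step b c)
  have bc: "b \<in> {1..Suc k}" "c \<in> {1..Suc k}" "(b, c) \<in> E" "b \<noteq> c"
    using step.hyps(2) E_range by (auto simp: restr_def)
  show ?case
  proof (cases "b = Suc k")
    case True
    then obtain x where x: "x \<in> nbrs E (Suc k)" "(a, x) \<in> (restr E k)\<^sup>*"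
      using step.IH by auto
    have c: "c \<in> nbrs E (Suc k)" using bc True E_sym by (auto simp: nbrs_iff le_neq_implies_less)
    show ?thesis
    proof (cases "x = c")
      case False
      then have "(x, c) \<in> restr E k"
        using nbrs_clique[OF x(1) c] x(1) c E_range by (fastforce simp: restr_def nbrs_iff)
      then show ?thesis using x(2) bc True by auto
    qed (use x bc True in auto)
  next
    case False
    then have ab: "(a, b) \<in> (restr E k)\<^sup>*" using step.IH by auto
    show ?thesis
    proof (cases "c = Suc k")
      case True
      then show ?thesis using ab bc by (auto simp: nbrs_iff)
    next
      case c: False
      then have "(b, c) \<in> restr E k" using bc False by (auto simp: restr_def)
      then show ?thesis using ab c by auto
    qed
  qed
qed

text \<open>Removing the last vertex preserves connectivity, because its neighbours form a clique
  and paths through it can be shortcut; hence the downward induction from \<open>n\<close>.\<close>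

lemma restr_connected:
  assumes "1 \<le> k" "k \<le> n" "u \<in> {1..k}" "v \<in> {1..k}"
  shows "(u, v) \<in> (restr E k)\<^sup>*"
  using assms(2,1,3,4)
proof (induction arbitrary: u v rule: inc_induct)
  case base
  have "restr E n = E" using E_range by (fastforce simp: restr_def)
  then show ?case using base connected by (auto simp: graph_connected_def)
next
  case (step k)
  then have "(u, v) \<in> (restr E (Suc k))\<^sup>*" by auto
  from restr_E_path_shortcut[OF this] show ?case using step by auto
qed

text \<open>Connectivity enters here: every vertex except 1 has an arc to flip, so the start
  \<open>t = 0\<close> of a sweep differs from its end \<open>t = d\<close>.\<close>

lemma nbrs_nonempty:
  assumes "2 \<le> k" "k \<le> n"
  shows "nbrs E k \<noteq> {}"
proof -
  have "(k, 1) \<in> (restr E k)\<^sup>*" using restr_connected assms by auto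
  then obtain y where "(k, y) \<in> restr E k"
    using assms by (auto elim: converse_rtranclE)
  then have "y \<in> nbrs E k" using E_range by (auto simp: restr_def nbrs_def)
  then show ?thesis by auto
qed

lemma card_nbrs_pos: "2 \<le> k \<Longrightarrow> k \<le> n \<Longrightarrow> 1 \<le> card (nbrs E k)"
  using nbrs_nonempty by (simp add: Suc_le_eq card_gt_0_iff)

section \<open>Degrees and the clique number\<close>

lemma card_clique_le: "S \<subseteq> {1..n} \<Longrightarrow> clique E S \<Longrightarrow> card S \<le> clique_number n E"
  unfolding clique_number_def by (rule Max_ge) auto

lemma card_nbrs_le: "k \<in> {1..n} \<Longrightarrow> card (nbrs E k) \<le> clique_number n E"
  using peo by (intro card_clique_le) (auto simp: nbrs_def perfect_elimination_order_def)

lemma clique_number_pos: "1 \<le> clique_number n E"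
  using card_clique_le[of "{1}"] connected by (auto simp: clique_def graph_connected_def)

end

section \<open>Running the machine\<close>

lemma run_charge [simp]: "run_state (charge k) c = ((), c\<lparr>clock := clock c + k\<rparr>)"
  by (simp add: charge_def State_Monad.update_def)

lemma run_rd [simp]:
  "run_state (rd arr i) c =
     (arr (c\<lparr>clock := Suc (clock c)\<rparr>) i, c\<lparr>clock := Suc (clock c)\<rparr>)"
  by (simp add: rd_def)

lemma run_wr [simp]:
  "run_state (wr upd i v) c = ((), upd (\<lambda>f. f(i := v)) (c\<lparr>clock := Suc (clock c)\<rparr>))"
  by (simp add: wr_def State_Monad.update_def)

lemma run_nbr_count [simp]:
  "run_state (nbr_count E j) c = (card (nbrs E j), c\<lparr>clock := Suc (clock c)\<rparr>)"
  by (simp add: nbr_count_def)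

lemma run_nbr_list [simp]:
  "run_state (nbr_list E j) c =
     (sorted_list_of_set (nbrs E j), c\<lparr>clock := clock c + card (nbrs E j)\<rparr>)"
  by (simp add: nbr_list_def)

definition orient :: "nat \<Rightarrow> config \<Rightarrow> (nat \<times> nat) set" where
  "orient n c = {(i, j) \<in> {1..n} \<times> {1..n}. mat c (i, j) = 1}"

lemma run_visit [simp]:
  "run_state (visit n) c =
     ((), c\<lparr>visits := visits c @ [orient n c], clock := Suc (clock c)\<rparr>)"
  by (simp add: visit_def orient_def State_Monad.update_def)

section \<open>Merge sort\<close>

lemma run_merge:
  fixes M :: "nat \<times> nat \<Rightarrow> nat"
  defines "r \<equiv> \<lambda>x y. M (x, y) = 1"
  assumes "mat c = M" "sorted_wrt r xs" "sorted_wrt r ys"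
    and "\<And>x y. x \<in> set xs \<Longrightarrow> y \<in> set ys \<Longrightarrow> r x y \<or> r y x"
    and "transp_on (set xs \<union> set ys) r"
  shows "\<exists>zs k. run_state (merge xs ys) c = (zs, c\<lparr>clock := clock c + k\<rparr>) \<and>
           k \<le> 2 * (length xs + length ys) + 1 \<and> mset zs = mset xs + mset ys \<and> sorted_wrt r zs"
  using assms(2-)
proof (induction xs ys arbitrary: c rule: merge.induct)
  case (1 ys)
  then show ?case by (intro exI[of _ ys] exI[of _ 1]) auto
next
  case (2 x xs)
  then show ?case by (intro exI[of _ "x # xs"] exI[of _ 1]) auto
next
  case (3 x xs y ys)
  note prems = "3.prems"
  let ?c = "c\<lparr>clock := Suc (Suc (clock c))\<rparr>"
  show ?case
  proof (cases "M (x, y) = 1")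
    case True
    have "\<exists>zs k. run_state (merge xs (y # ys)) ?c = (zs, ?c\<lparr>clock := clock ?c + k\<rparr>) \<and>
           k \<le> 2 * (length xs + length (y # ys)) + 1 \<and> mset zs = mset xs + mset (y # ys) \<and>
           sorted_wrt r zs"
    proof (rule "3.IH"(1)[OF True])
      show "transp_on (set xs \<union> set (y # ys)) r"
        by (rule transp_on_subset[OF prems(5)]) auto
    qed (use prems in auto)
    then obtain zs k where zs: "run_state (merge xs (y # ys)) ?c = (zs, ?c\<lparr>clock := clock ?c + k\<rparr>)"
      "k \<le> 2 * (length xs + length (y # ys)) + 1" "mset zs = mset xs + mset (y # ys)"
      "sorted_wrt r zs" by blast
    have "set zs = set xs \<union> set (y # ys)"
      using mset_eq_setD[of zs "xs @ y # ys"] zs(3) by simp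
    moreover have "r x z" if "z \<in> set ys" for z
      using transp_onD[OF prems(5), of x y z] prems(3) True that by (simp add: r_def)
    ultimately have "sorted_wrt r (x # zs)"
      using zs(4) prems(2) True by (auto simp: r_def)
    \<comment> \<open>Each emitted element costs 2: one charge and one matrix lookup.\<close>
    then show ?thesis
      using zs True prems(1) by (intro exI[of _ "x # zs"] exI[of _ "k + 2"]) auto
  next
    case False
    then have yx: "r y x" using prems(4)[of x y] by (auto simp: r_def)
    have "\<exists>zs k. run_state (merge (x # xs) ys) ?c = (zs, ?c\<lparr>clock := clock ?c + k\<rparr>) \<and>
           k \<le> 2 * (length (x # xs) + length ys) + 1 \<and> mset zs = mset (x # xs) + mset ys \<and>
           sorted_wrt r zs"
    proof (rule "3.IH"(2)[OF False])
      show "transp_on (set (x # xs) \<union> set ys) r"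
        by (rule transp_on_subset[OF prems(5)]) auto
    qed (use prems in auto)
    then obtain zs k where zs: "run_state (merge (x # xs) ys) ?c = (zs, ?c\<lparr>clock := clock ?c + k\<rparr>)"
      "k \<le> 2 * (length (x # xs) + length ys) + 1" "mset zs = mset (x # xs) + mset ys"
      "sorted_wrt r zs" by blast
    have "set zs = set (x # xs) \<union> set ys"
      using mset_eq_setD[of zs "(x # xs) @ ys"] zs(3) by simp
    moreover have "r y z" if "z \<in> set xs" for z
      using transp_onD[OF prems(5), of y x z] prems(2) yx that by (simp add: r_def)
    ultimately have "sorted_wrt r (y # zs)"
      using zs(4) prems(3) yx by auto
    then show ?thesis
      using zs False prems(1) by (intro exI[of _ "y # zs"] exI[of _ "k + 2"]) auto
  qed
qed

text \<open>The parameter \<open>l\<close> bounds the recursion depth. A call on \<open>m\<close>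
  elements pays \<open>m\<close> for splitting and at most \<open>2 * m + 1\<close> for merging,
  together at most \<open>4 * m\<close>.\<close>

lemma run_msort:
  fixes M :: "nat \<times> nat \<Rightarrow> nat"
  defines "r \<equiv> \<lambda>x y. M (x, y) = 1"
  assumes "mat c = M" "distinct xs"
    and "\<And>x y. x \<in> set xs \<Longrightarrow> y \<in> set xs \<Longrightarrow> x \<noteq> y \<Longrightarrow> r x y \<or> r y x"
    and "transp_on (set xs) r"
    and "xs \<noteq> []" "length xs \<le> 2 ^ l"
  shows "\<exists>zs k. run_state (msort xs) c = (zs, c\<lparr>clock := clock c + k\<rparr>) \<and>
           k \<le> 4 * length xs * (l + 1) \<and> mset zs = mset xs \<and> sorted_wrt r zs"
  using assms(2-)
proof (induction "length xs" arbitrary: c xs l rule: less_induct)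
  case less
  note prems = less.prems
  show ?case
  proof (cases "length xs \<le> 1")
    case True
    then obtain x where "xs = [x]" using prems(5) by (cases xs) auto
    then show ?thesis
      by (intro exI[of _ xs] exI[of _ 1]) (simp add: msort.simps)
  next
    case False
    let ?h = "length xs div 2" and ?c = "c\<lparr>clock := clock c + length xs\<rparr>"
    obtain l' where l: "l = Suc l'" using prems(6) False by (cases l) auto
    have sub: "set (take ?h xs) \<subseteq> set xs" "set (drop ?h xs) \<subseteq> set xs"
      by (auto dest: in_set_takeD in_set_dropD)
    have "\<exists>zs k. run_state (msort (take ?h xs)) ?c = (zs, ?c\<lparr>clock := clock ?c + k\<rparr>) \<and>
           k \<le> 4 * length (take ?h xs) * (l' + 1) \<and> mset zs = mset (take ?h xs) \<and> sorted_wrt r zs"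
    proof (rule less.hyps)
      show "transp_on (set (take ?h xs)) r" using prems(4) sub transp_on_subset by blast
      show "r x y \<or> r y x" if "x \<in> set (take ?h xs)" "y \<in> set (take ?h xs)" "x \<noteq> y" for x y
        using prems(3) that sub by blast
    qed (use False prems l in auto)
    then obtain ys k where ys: "run_state (msort (take ?h xs)) ?c = (ys, ?c\<lparr>clock := clock ?c + k\<rparr>)"
      "k \<le> 4 * length (take ?h xs) * (l' + 1)" "mset ys = mset (take ?h xs)" "sorted_wrt r ys"
      by blast
    let ?d = "?c\<lparr>clock := clock ?c + k\<rparr>"
    have "\<exists>zs k. run_state (msort (drop ?h xs)) ?d = (zs, ?d\<lparr>clock := clock ?d + k\<rparr>) \<and>
           k \<le> 4 * length (drop ?h xs) * (l' + 1) \<and> mset zs = mset (drop ?h xs) \<and> sorted_wrt r zs"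
    proof (rule less.hyps)
      show "transp_on (set (drop ?h xs)) r" using prems(4) sub transp_on_subset by blast
      show "r x y \<or> r y x" if "x \<in> set (drop ?h xs)" "y \<in> set (drop ?h xs)" "x \<noteq> y" for x y
        using prems(3) that sub by blast
    qed (use False prems l in auto)
    then obtain zs k' where zs: "run_state (msort (drop ?h xs)) ?d = (zs, ?d\<lparr>clock := clock ?d + k'\<rparr>)"
      "k' \<le> 4 * length (drop ?h xs) * (l' + 1)" "mset zs = mset (drop ?h xs)" "sorted_wrt r zs"
      by blast
    let ?e = "?d\<lparr>clock := clock ?d + k'\<rparr>"
    have sets: "set ys = set (take ?h xs)" "set zs = set (drop ?h xs)"
      using ys(3) zs(3) by (auto dest: mset_eq_setD)
    have lens: "length ys = length (take ?h xs)" "length zs = length (drop ?h xs)"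
      using ys(3) zs(3) by (auto dest: mset_eq_length)
    have "\<exists>us m. run_state (merge ys zs) ?e = (us, ?e\<lparr>clock := clock ?e + m\<rparr>) \<and>
           m \<le> 2 * (length ys + length zs) + 1 \<and> mset us = mset ys + mset zs \<and> sorted_wrt r us"
      unfolding r_def
    proof (rule run_merge)
      have "set (take ?h xs) \<inter> set (drop ?h xs) = {}"
        using prems(2) by (simp add: set_take_disj_set_drop_if_distinct)
      then show "M (x, y) = 1 \<or> M (y, x) = 1" if "x \<in> set ys" "y \<in> set zs" for x y
        using that sub prems(3)[of x y] unfolding sets r_def by blast
      show "transp_on (set ys \<union> set zs) (\<lambda>x y. M (x, y) = 1)"
        by (rule transp_on_subset[OF prems(4)[unfolded r_def]]) (use sub sets in auto)
    qed (use prems ys(4) zs(4) in \<open>auto simp: r_def\<close>)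
    then obtain us m where us: "run_state (merge ys zs) ?e = (us, ?e\<lparr>clock := clock ?e + m\<rparr>)"
      "m \<le> 2 * (length ys + length zs) + 1" "mset us = mset ys + mset zs" "sorted_wrt r us"
      by blast
    have len: "length (take ?h xs) + length (drop ?h xs) = length xs" by auto
    have "k + k' \<le> 4 * (length (take ?h xs) + length (drop ?h xs)) * (l' + 1)"
      using ys(2) zs(2) by (simp only: distrib_left distrib_right)
    then have cost: "length xs + k + k' + m \<le> 4 * length xs * (l + 1)"
      using us(2) lens len False l by simp
    have "mset us = mset xs"
      using us(3) ys(3) zs(3) by (metis append_take_drop_id mset_append)
    then show ?thesis
      using us(4) cost False ys(1) zs(1) us(1)
      by (intro exI[of _ us] exI[of _ "length xs + k + k' + m"])
        (simp add: msort.simps[of xs] add.assoc)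
  qed
qed

section \<open>Writing the order \<open>T_j\<close>\<close>

lemma run_store_up:
  "run_state (store_up j k vs) c = ((), c\<lparr>
     ordT := (\<lambda>(i, p). if i = j \<and> k \<le> p \<and> p < k + length vs then vs ! (p - k) else ordT c (i, p)),
     clock := clock c + length vs\<rparr>)"
proof (induction vs arbitrary: k c)
  case (Cons v vs)
  show ?case
    by (auto simp: Cons.IH fun_eq_iff nth_Cons' Suc_diff_le split: nat.split
        intro!: arg_cong[of _ _ "nth vs"])
qed (auto intro!: config.equality)

text \<open>The hypothesis keeps all written positions at least 1, so the subtraction
  \<open>k - 1\<close> is never truncated.\<close>

lemma run_store_down:
  "length vs \<le> k \<Longrightarrow> run_state (store_down j k vs) c = ((), c\<lparr>
     ordT := (\<lambda>(i, p). if i = j \<and> p \<le> k \<and> k < p + length vs then vs ! (k - p) else ordT c (i, p)),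
     clock := clock c + length vs\<rparr>)"
proof (induction vs arbitrary: k c)
  case (Cons v vs)
  then have "length vs \<le> k - 1" "k \<ge> 1" by auto
  then show ?case
    by (auto simp: Cons.IH nth_Cons' fun_eq_iff intro!: config.equality)
qed (auto intro!: config.equality)

lemma orient_iff: "(x, y) \<in> orient n c \<longleftrightarrow> x \<in> {1..n} \<and> y \<in> {1..n} \<and> mat c (x, y) = 1"
  by (simp add: orient_def)

section \<open>Effect and cost of one round\<close>

context peo_graph
begin

text \<open>Using \<open>od (dir c j) D\<close> absorbs the distinction on \<open>o_j\<close>:
  filling downwards for \<open>L\<close> and upwards for \<open>R\<close> yields the same ordering
  condition.\<close>

lemma run_stepA4:
  assumes j: "2 \<le> j" "j \<le> n" and D: "D = orient n c" "orientation E D" "triangle_free D"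
    and ptr: "ptr c j = 0 \<or> lists_order E j (\<lambda>q. ordT c (j, q)) (od (dir c j) D)"
    and l: "card (nbrs E j) \<le> 2 ^ l"
  shows "\<exists>X k. run_state (stepA4 E j) c = ((), c\<lparr>ordT := X, clock := clock c + k\<rparr>) \<and>
     (\<forall>p q. p \<noteq> j \<longrightarrow> X (p, q) = ordT c (p, q)) \<and>
     lists_order E j (\<lambda>q. X (j, q)) (od (dir c j) D) \<and>
     k \<le> 1 + (if ptr c j = 0 then 4 * (l + 2) * card (nbrs E j) else 0)"
proof (cases "ptr c j = 0")
  case False
  then show ?thesis using ptr
    by (intro exI[of _ "ordT c"] exI[of _ 1]) (simp add: stepA4_def)
next
  case True
  let ?N = "nbrs E j" and ?r = "\<lambda>x y. mat c (x, y) = 1"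
  let ?ns = "sorted_list_of_set ?N" and ?d = "card ?N"
  let ?c = "c\<lparr>clock := Suc (clock c) + ?d\<rparr>"
  have d: "1 \<le> ?d" using card_nbrs_pos j by simp
  have r: "?r x y \<longleftrightarrow> (x, y) \<in> D" if "x \<in> ?N" "y \<in> ?N" for x y
    using that E_range by (fastforce simp: D orient_iff nbrs_iff)
  have "\<exists>zs k. run_state (msort ?ns) ?c = (zs, ?c\<lparr>clock := clock ?c + k\<rparr>) \<and>
           k \<le> 4 * length ?ns * (l + 1) \<and> mset zs = mset ?ns \<and> sorted_wrt ?r zs"
  proof (rule run_msort)
    show "?r x y \<or> ?r y x" if "x \<in> set ?ns" "y \<in> set ?ns" "x \<noteq> y" for x y
      using that r orientation_tournament[OF D(2), of x j y] by simp
    \<comment> \<open>In a tournament, absence of directed triangles yields transitivity.\<close>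
    show "transp_on (set ?ns) ?r"
    proof (rule transp_onI)
      fix x y z assume xyz: "x \<in> set ?ns" "y \<in> set ?ns" "z \<in> set ?ns" "?r x y" "?r y z"
      then have D': "(x, y) \<in> D" "(y, z) \<in> D" using r by auto
      then have "x \<noteq> z" "(z, x) \<notin> D"
        using orientation_asym[OF D(2)] D(3) unfolding triangle_free_def by blast+
      then show "?r x z" using xyz r orientation_tournament[OF D(2), of x j z] by simp
    qed
    show "?ns \<noteq> []" "length ?ns \<le> 2 ^ l" using d l by auto
  qed auto
  then obtain vs k where vs: "run_state (msort ?ns) ?c = (vs, ?c\<lparr>clock := clock ?c + k\<rparr>)"
    "k \<le> 4 * length ?ns * (l + 1)" "mset vs = mset ?ns" "sorted_wrt ?r vs"
    by blast
  have set: "set vs = ?N" using mset_eq_setD[OF vs(3)] by simp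
  have dist: "distinct vs" using vs(3) by (metis distinct_sorted_list_of_set mset_eq_imp_distinct_iff)
  have len: "length vs = ?d" using mset_eq_length[OF vs(3)] by simp
  have srt: "(vs ! a, vs ! b) \<in> D" if "a < b" "b < ?d" for a b
  proof -
    have "vs ! a \<in> ?N" "vs ! b \<in> ?N" using that len set nth_mem[of _ vs] by auto
    moreover have "?r (vs ! a) (vs ! b)" using sorted_wrt_nth_less[OF vs(4)] that len by simp
    ultimately show ?thesis using r by blast
  qed
  have bij: "bij_betw (nth vs) {..<?d} ?N"
    using bij_betw_nth[OF dist] set len by auto
  \<comment> \<open>Besides the sort there are two traversals, for reading \<open>N_j\<close> and
    storing \<open>T_j\<close>, and two lookups; \<open>2 * d + 2\<close> fits into
    \<open>4 * d\<close> as \<open>1 \<le> d\<close>.\<close>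
  have cost: "?d + k + 2 + ?d \<le> 4 * (l + 2) * ?d"
    using vs(2) d by (simp add: algebra_simps)
  show ?thesis
  proof (cases "dir c j")
    case L
    let ?X = "\<lambda>(i, p). if i = j \<and> p \<le> ?d \<and> ?d < p + length vs then vs ! (?d - p) else ordT c (i, p)"
    have "bij_betw (\<lambda>p. ?d - p) {1..?d} {..<?d}"
      by (rule bij_betw_byWitness[where f' = "\<lambda>p. ?d - p"]) auto
    from bij_betw_trans[OF this bij] have "bij_betw (\<lambda>p. ?X (j, p)) {1..?d} ?N"
      by (rule bij_betw_cong[THEN iffD1, rotated]) (auto simp: len)
    then have "lists_order E j (\<lambda>q. ?X (j, q)) D"
      unfolding lists_order_def using srt by (auto simp: len)
    then show ?thesis
      using True L vs(1) cost
      by (intro exI[of _ ?X] exI[of _ "1 + (?d + k + 2 + ?d)"])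
        (auto simp: stepA4_def run_store_down len intro!: config.equality)
  next
    case R
    let ?X = "\<lambda>(i, p). if i = j \<and> 1 \<le> p \<and> p < 1 + length vs then vs ! (p - 1) else ordT c (i, p)"
    have "bij_betw (\<lambda>p. p - 1) {1..?d} {..<?d}"
      by (rule bij_betw_byWitness[where f' = "\<lambda>p. p + 1"]) auto
    from bij_betw_trans[OF this bij] have "bij_betw (\<lambda>p. ?X (j, p)) {1..?d} ?N"
      by (rule bij_betw_cong[THEN iffD1, rotated]) (auto simp: len)
    then have "lists_order E j (\<lambda>q. ?X (j, q)) (D\<inverse>)"
      unfolding lists_order_def using srt by (auto simp: len)
    then show ?thesis
      using True R vs(1) cost
      by (intro exI[of _ ?X] exI[of _ "1 + (?d + k + 2 + ?d)"])
        (auto simp: stepA4_def run_store_up len intro!: config.equality)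
  qed
qed

text \<open>The constant 19 consists of 2 for visit and selection, 1 for reading \<open>t_j\<close>
  in A4, 7 for A5 and at most 9 for A6.\<close>

lemma run_one_round:
  assumes sel: "sel c n = j" and j: "2 \<le> j" "j \<le> n"
    and D: "D = orient n c" "orientation E D" "triangle_free D"
    and t: "ptr c j = t" "t < card (nbrs E j)"
    and ord: "t = 0 \<or> lists_order E j (\<lambda>q. ordT c (j, q)) (od (dir c j) D)"
    and l: "card (nbrs E j) \<le> 2 ^ l"
  shows "\<exists>c' i. run_state (one_round n E) c = (False, c') \<and>
     visits c' = visits c @ [D] \<and>
     clock c' \<le> clock c + 19 + (if t = 0 then 4 * (l + 2) * card (nbrs E j) else 0) \<and>
     (\<forall>p q. p \<noteq> j \<longrightarrow> ordT c' (p, q) = ordT c (p, q)) \<and>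
     lists_order E j (\<lambda>q. ordT c' (j, q)) (od (dir c j) D) \<and>
     i = ordT c' (j, Suc t) \<and>
     od (dir c j) (orient n c') = od (dir c j) D - {(i, j)} \<union> {(j, i)} \<and>
     (if Suc t = card (nbrs E j)
      then dir c' = (dir c)(j := opp (dir c j)) \<and> ptr c' = (ptr c)(j := 0) \<and>
           sel c' = (sel c)(n := n, j := ((sel c)(n := n)) (j - 1), j - 1 := j - 1)
      else dir c' = dir c \<and> ptr c' = (ptr c)(j := Suc t) \<and> sel c' = (sel c)(n := n))"
proof -
  let ?c0 = "c\<lparr>visits := visits c @ [D], clock := clock c + 2\<rparr>"
  have "\<exists>X k. run_state (stepA4 E j) ?c0 = ((), ?c0\<lparr>ordT := X, clock := clock ?c0 + k\<rparr>) \<and>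
     (\<forall>p q. p \<noteq> j \<longrightarrow> X (p, q) = ordT ?c0 (p, q)) \<and>
     lists_order E j (\<lambda>q. X (j, q)) (od (dir ?c0 j) D) \<and>
     k \<le> 1 + (if ptr ?c0 j = 0 then 4 * (l + 2) * card (nbrs E j) else 0)"
    by (rule run_stepA4) (use assms in \<open>auto simp: orient_def\<close>)
  then obtain X k where X: "run_state (stepA4 E j) ?c0 = ((), ?c0\<lparr>ordT := X, clock := clock ?c0 + k\<rparr>)"
    "\<And>p q. p \<noteq> j \<Longrightarrow> X (p, q) = ordT c (p, q)"
    "lists_order E j (\<lambda>q. X (j, q)) (od (dir c j) D)"
    "k \<le> 1 + (if t = 0 then 4 * (l + 2) * card (nbrs E j) else 0)"
    using t by auto
  define i where "i = X (j, Suc t)"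
  have "i \<in> nbrs E j"
    using X(3) t(2) bij_betwE unfolding lists_order_def i_def by fastforce
  then have i: "i \<in> {1..n}" "i \<noteq> j" "j \<in> {1..n}" "i < j"
    using E_range by (auto simp: nbrs_iff)
  define M where "M = (case dir c j of L \<Rightarrow> (mat c)((i, j) := 0, (j, i) := 1)
                                     | R \<Rightarrow> (mat c)((i, j) := 1, (j, i) := 0))"
  \<comment> \<open>The updates are nested in the order of the writes: for \<open>j = n\<close> at
    the end of a sweep, \<open>s_n\<close> receives the old \<open>s_(n-1)\<close>, not
    \<open>n\<close>.\<close>
  define S where "S = (if Suc t = card (nbrs E j)
     then (sel c)(n := n, j := ((sel c)(n := n)) (j - 1), j - 1 := j - 1) else (sel c)(n := n))"
  define c' where "c' = ?c0\<lparr>mat := M, ordT := X,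
     ptr := (ptr c)(j := if Suc t = card (nbrs E j) then 0 else Suc t),
     dir := (if Suc t = card (nbrs E j) then (dir c)(j := opp (dir c j)) else dir c),
     sel := S, clock := clock c + k + (if Suc t = card (nbrs E j) then 18 else 12)\<rparr>"
  have "run_state (one_round n E) c = (False, c')"
    using sel j X(1) t D(1)
    by (cases "dir c j") (auto simp: one_round_def stepA5_def stepA6_def c'_def M_def S_def i_def opp_def
        numeral_eq_Suc)
  moreover have "od (dir c j) (orient n c') = od (dir c j) D - {(i, j)} \<union> {(j, i)}"
    using i by (cases "dir c j") (auto simp: c'_def M_def D orient_iff split: if_splits)
  ultimately show ?thesis
    using X(2-4) by (intro exI[of _ c'] exI[of _ i]) (auto simp: c'_def S_def i_def)
qed


section \<open>The recursive structure of a run\<close>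

lemma restr_pred: "restr D k = restr D' k \<Longrightarrow> restr D (k - 1) = restr D' (k - 1)"
proof -
  have "restr X (k - 1) = restr (restr X k) (k - 1)" for X by (auto simp: restr_def)
  then show "restr D k = restr D' k \<Longrightarrow> restr D (k - 1) = restr D' (k - 1)" by metis
qed

lemma outs_cong_restr:
  assumes "restr D k = restr D' k"
  shows "outs E k (od w D) = outs E k (od w D')"
proof -
  have *: "outs E k X = {i \<in> nbrs E k. (k, i) \<in> restr X k}" for X
    using E_range by (fastforce simp: outs_def restr_def nbrs_iff)
  have "restr (od w D) k = restr (od w D') k" using assms by (simp add: restr_od)
  then show ?thesis by (simp add: *)
qed

text \<open>Splits the orientations with a common restriction to \<open>[k - 1]\<close> by
  out-degree at \<open>k\<close> into the classes that segments of level \<open>k\<close>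
  enumerate.\<close>

lemma restr_fibre:
  assumes "D \<in> acyclic_orientations E" "C \<in> acyclic_orientations E"
  shows "restr D k = restr C k \<longleftrightarrow> restr D (k - 1) = restr C (k - 1) \<and>
           card (outs E k (od w D)) = card (outs E k (od w C))"
  using restr_pred[of D k C] outs_cong_restr[of D k C w] restr_eq_if_card_outs_eq[of D C k w]
    assms unfolding acyclic_orientations_iff by metis

lemma lists_order_cong:
  assumes "\<And>x y. x \<in> nbrs E j \<Longrightarrow> y \<in> nbrs E j \<Longrightarrow> (x, y) \<in> A \<longleftrightarrow> (x, y) \<in> A'"
    and "lists_order E j T A"
  shows "lists_order E j T A'"
proof -
  have "T p \<in> nbrs E j" if "1 \<le> p" "p \<le> card (nbrs E j)" for p
    using assms(2) that bij_betwE unfolding lists_order_def by fastforce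
  then show ?thesis using assms unfolding lists_order_def by (meson le_trans less_imp_le)
qed

text \<open>Vertex \<open>j\<close> is a sink of \<open>D_j\<close> for direction \<open>L\<close>
  and a source for \<open>R\<close>, ready to begin its next sweep.\<close>

definition swept :: "config \<Rightarrow> nat \<Rightarrow> bool" where
  "swept c j \<longleftrightarrow> ptr c j = 0 \<and> (\<forall>i\<in>nbrs E j. (i, j) \<in> od (dir c j) (orient n c))"

definition step :: "config \<Rightarrow> config \<Rightarrow> bool" where
  "step c c' \<longleftrightarrow> run_state (one_round n E) c = (False, c')"

text \<open>The entry \<open>s_k\<close> stays free: it is the return address, naming the vertex
  that acts once the segment of level \<open>k\<close> ends.\<close>

definition fresh :: "nat \<Rightarrow> config \<Rightarrow> bool" where
  "fresh k c \<longleftrightarrow> orient n c \<in> acyclic_orientations E \<and>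
     (\<forall>j. k < j \<longrightarrow> j \<le> n \<longrightarrow> swept c j \<and> sel c j = j)"

definition unchanged :: "nat \<Rightarrow> config \<Rightarrow> config \<Rightarrow> bool" where
  "unchanged j c c' \<longleftrightarrow> ptr c' j = ptr c j \<and> dir c' j = dir c j \<and> (\<forall>p. ordT c' (j, p) = ordT c (j, p))"

text \<open>The rounds from \<open>c\<close> to \<open>c'\<close> together with the visit about to happen in \<open>c'\<close> run through
  all acyclic orientations that agree with the one in \<open>c\<close> on \<open>[k]\<close>. Afterwards the next vertex
  selected is the one stored in \<open>s\<^sub>k\<close> at the beginning.\<close>

definition segment :: "nat \<Rightarrow> nat \<Rightarrow> config \<Rightarrow> config \<Rightarrow> bool" where
  "segment B k c c' \<longleftrightarrow> step\<^sup>*\<^sup>* c c' \<and> orient n c' \<in> acyclic_orientations E \<and>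
     restr (orient n c') k = restr (orient n c) k \<and>
     (\<forall>j. k < j \<longrightarrow> j \<le> n \<longrightarrow> swept c' j) \<and>
     (\<forall>j\<le>k. unchanged j c c') \<and>
     sel c' n = sel c k \<and> (\<forall>j. k \<le> j \<longrightarrow> j < n \<longrightarrow> sel c' j = j) \<and> (\<forall>j<k. sel c' j = sel c j) \<and>
     (\<exists>vs. visits c' @ [orient n c'] = visits c @ vs \<and> distinct vs \<and>
        set vs = {D \<in> acyclic_orientations E. restr D k = restr (orient n c) k}) \<and>
     clock c' + B * length (visits c) \<le> clock c + B * length (visits c')"

text \<open>Configuration after \<open>t\<close> flips of arcs at \<open>k\<close> within the segment of level \<open>k - 1\<close> that starts
  in \<open>c0\<close>. Every flip adds one out-neighbour of \<open>k\<close> (in-neighbour, for direction R). A sort of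
  cost at most \<open>b * |N\<^sub>k|\<close> is paid for by the \<open>|N\<^sub>k|\<close> flips following it.\<close>

definition sweeping :: "nat \<Rightarrow> nat \<Rightarrow> config \<Rightarrow> nat \<Rightarrow> config \<Rightarrow> bool" where
  "sweeping b k c0 t c \<longleftrightarrow> (let d = card (nbrs E k); w = dir c0 k; B = b + 19 in
     step\<^sup>*\<^sup>* c0 c \<and> fresh k c \<and>
     restr (orient n c) (k - 1) = restr (orient n c0) (k - 1) \<and>
     card (outs E k (od w (orient n c))) = t \<and>
     ptr c k = (if t = d then 0 else t) \<and> dir c k = (if t = d then opp w else w) \<and>
     (0 < t \<longrightarrow> t < d \<longrightarrow> lists_order E k (\<lambda>q. ordT c (k, q)) (od w (orient n c))) \<and>
     sel c k = (if t = d then sel c0 (k - 1) else k) \<and>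
     (\<forall>j<k. sel c j = (if t = d \<and> j = k - 1 then k - 1 else sel c0 j)) \<and>
     (\<forall>j<k. unchanged j c0 c) \<and>
     (\<exists>vs. visits c = visits c0 @ vs \<and> distinct vs \<and>
        set vs = {D \<in> acyclic_orientations E. restr D (k - 1) = restr (orient n c0) (k - 1) \<and>
                    card (outs E k (od w D)) < t}) \<and>
     clock c + B * length (visits c0) + b * t
       \<le> clock c0 + B * length (visits c) + (if t = 0 then 0 else b * d))"

section \<open>One sweep of the vertex \<open>k\<close>\<close>

lemma orient_AO:
  "orient n c \<in> acyclic_orientations E \<Longrightarrow> orientation E (orient n c) \<and> triangle_free (orient n c)"
  by (simp add: acyclic_orientations_iff)

lemma sweeping_0:
  assumes k: "2 \<le> k" "k \<le> n" and c: "fresh (k - 1) c"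
  shows "sweeping b k c 0 c"
proof -
  have "swept c k" "sel c k = k" "fresh k c"
    using c k by (auto simp: fresh_def)
  then have "outs E k (od (dir c k) (orient n c)) = {}" "ptr c k = 0"
    using orientation_asym[of "od (dir c k) (orient n c)"] orient_AO[of c]
    by (auto simp: outs_def swept_def orientation_od fresh_def)
  then show ?thesis
    using \<open>sel c k = k\<close> \<open>fresh k c\<close> card_nbrs_pos[OF k]
    by (auto simp: sweeping_def Let_def unchanged_def)
qed

text \<open>By \<open>restr_fibre\<close> the segment contributes exactly the orientations of
  out-degree \<open>t\<close>. The one in \<open>c1\<close> is appended because its visit only opens
  the next round.\<close>

lemma enumeration_extend:
  assumes k: "2 \<le> k" "k \<le> n" and sw: "sweeping b k c0 t c" and seg: "segment B k c c1"
  shows "\<exists>vs. visits c1 @ [orient n c1] = visits c0 @ vs \<and> distinct vs \<and>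
     set vs = {D \<in> acyclic_orientations E. restr D (k - 1) = restr (orient n c0) (k - 1) \<and>
                    card (outs E k (od (dir c0 k) D)) < Suc t}"
proof -
  obtain vs where vs: "visits c = visits c0 @ vs" "distinct vs"
    "set vs = {D \<in> acyclic_orientations E. restr D (k - 1) = restr (orient n c0) (k - 1) \<and>
                    card (outs E k (od (dir c0 k) D)) < t}"
    using sw by (auto simp: sweeping_def Let_def)
  obtain ws where ws: "visits c1 @ [orient n c1] = visits c @ ws" "distinct ws"
    "set ws = {D \<in> acyclic_orientations E. restr D k = restr (orient n c) k}"
    using seg by (auto simp: segment_def)
  have c: "orient n c \<in> acyclic_orientations E"
    "restr (orient n c) (k - 1) = restr (orient n c0) (k - 1)"
    "card (outs E k (od (dir c0 k) (orient n c))) = t"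
    using sw by (auto simp: sweeping_def Let_def fresh_def)
  have "set ws = {D \<in> acyclic_orientations E. restr D (k - 1) = restr (orient n c0) (k - 1) \<and>
                    card (outs E k (od (dir c0 k) D)) = t}"
    using restr_fibre[OF _ c(1), of _ k "dir c0 k"] c(2,3) unfolding ws(3) by auto
  then have "visits c1 @ [orient n c1] = visits c0 @ (vs @ ws)" "distinct (vs @ ws)"
    "set (vs @ ws) = {D \<in> acyclic_orientations E. restr D (k - 1) = restr (orient n c0) (k - 1) \<and>
                    card (outs E k (od (dir c0 k) D)) < Suc t}"
    using vs ws(1,2) by auto
  then show ?thesis by blast
qed

text \<open>The segment exhausts the current restriction to \<open>[k]\<close> and, as
  \<open>s_k = k\<close>, returns control to \<open>k\<close>; one more round flips the next arc at
  \<open>k\<close>.\<close>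

lemma sweeping_Suc:
  assumes k: "2 \<le> k" "k \<le> n" and sw: "sweeping b k c0 t c" and t: "t < card (nbrs E k)"
    and seg: "segment (b + 19) k c c1"
    and l: "card (nbrs E k) \<le> 2 ^ l" and b: "b = 4 * (l + 2)"
  shows "\<exists>c2. sweeping b k c0 (Suc t) c2"
proof -
  let ?d = "card (nbrs E k)" and ?w = "dir c0 k" and ?D1 = "orient n c1"
  let ?A = "od ?w ?D1"
  have c: "step\<^sup>*\<^sup>* c0 c" "fresh k c" "restr (orient n c) (k - 1) = restr (orient n c0) (k - 1)"
    "card (outs E k (od ?w (orient n c))) = t" "ptr c k = t" "dir c k = ?w"
    "0 < t \<Longrightarrow> lists_order E k (\<lambda>q. ordT c (k, q)) (od ?w (orient n c))"
    "sel c k = k" "\<forall>j<k. sel c j = sel c0 j" "\<forall>j<k. unchanged j c0 c"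
    "clock c + (b + 19) * length (visits c0) + b * t
       \<le> clock c0 + (b + 19) * length (visits c) + (if t = 0 then 0 else b * ?d)"
    using sw t by (auto simp: sweeping_def Let_def)
  have c1: "step\<^sup>*\<^sup>* c c1" "?D1 \<in> acyclic_orientations E"
     "restr ?D1 k = restr (orient n c) k" "\<And>j. k < j \<Longrightarrow> j \<le> n \<Longrightarrow> swept c1 j"
     "\<forall>j\<le>k. unchanged j c c1" "sel c1 n = sel c k"
     "\<And>j. k \<le> j \<Longrightarrow> j < n \<Longrightarrow> sel c1 j = j" "\<And>j. j < k \<Longrightarrow> sel c1 j = sel c j"
     "clock c1 + (b + 19) * length (visits c) \<le> clock c + (b + 19) * length (visits c1)"
    using seg by (auto simp: segment_def)
  have D1: "orientation E ?D1" "triangle_free ?D1" using orient_AO c1(2) by auto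
  then have A: "orientation E ?A" "triangle_free ?A"
    by (simp_all add: orientation_od triangle_free_od)
  have k1: "ptr c1 k = t" "dir c1 k = ?w" "\<And>p. ordT c1 (k, p) = ordT c (k, p)"
    using c1(5) c(5,6) by (auto simp: unchanged_def)
  have "restr ?A (k - 1) = restr (od ?w (orient n c)) (k - 1)"
    using restr_pred[OF c1(3)] by (simp add: restr_od)
  note agree = restr_eq_nbrs[OF this]
  \<comment> \<open>The order sorted at the start of the sweep stays valid, since the arcs within
    \<open>N_k\<close> lie in \<open>[k - 1]\<close>.\<close>
  have ord: "t = 0 \<or> lists_order E k (\<lambda>q. ordT c1 (k, q)) (od (dir c1 k) ?D1)"
  proof (cases "t = 0")
    case False
    then have "lists_order E k (\<lambda>q. ordT c (k, q)) (od ?w (orient n c))" using c(7) by simp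
    then have "lists_order E k (\<lambda>q. ordT c (k, q)) ?A"
      by (rule lists_order_cong[rotated]) (use agree in auto)
    then show ?thesis using k1 by simp
  qed simp
  have "sel c1 n = k" using c1(6) c(8) by simp
  from run_one_round[OF this k refl D1 k1(1) t ord l, unfolded k1(2)]
  obtain c2 i where c2: "run_state (one_round n E) c1 = (False, c2)"
     "visits c2 = visits c1 @ [?D1]"
     "clock c2 \<le> clock c1 + 19 + (if t = 0 then 4 * (l + 2) * ?d else 0)"
     "\<And>p q. p \<noteq> k \<Longrightarrow> ordT c2 (p, q) = ordT c1 (p, q)"
     "lists_order E k (\<lambda>q. ordT c2 (k, q)) ?A"
     "i = ordT c2 (k, Suc t)"
     "od ?w (orient n c2) = ?A - {(i, k)} \<union> {(k, i)}"
     "if Suc t = ?d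
      then dir c2 = (dir c1)(k := opp ?w) \<and> ptr c2 = (ptr c1)(k := 0) \<and>
           sel c2 = (sel c1)(n := n, k := ((sel c1)(n := n)) (k - 1), k - 1 := k - 1)
      else dir c2 = dir c1 \<and> ptr c2 = (ptr c1)(k := Suc t) \<and> sel c2 = (sel c1)(n := n)"
    by blast
  have outs1: "card (outs E k ?A) = t"
    using outs_cong_restr[OF c1(3), of ?w] c(4) by simp
  \<comment> \<open>The direction of \<open>j\<close> may differ from that of \<open>k\<close>,
    hence the two alternatives.\<close>
  have "outs E j ?A = {} \<or> outs E j ?A = nbrs E j" if "k < j" for j
  proof (cases "j \<le> n")
    case True
    then have "\<forall>i\<in>nbrs E j. (i, j) \<in> od (dir c1 j) ?D1"
      using c1(4)[OF that] by (simp add: swept_def)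
    then show ?thesis
      using orientation_asym[OF D1(1)] by (cases ?w; cases "dir c1 j") (auto simp: outs_def)
  next
    case False
    then show ?thesis using E_range by (fastforce simp: outs_def nbrs_iff)
  qed
  note flip = triangle_free_flip[OF A c2(5) outs1 t c2(6) this c2(7)]
  have i: "i < k" using flip(1) by (simp add: nbrs_iff)
  have AO2: "orient n c2 \<in> acyclic_orientations E"
    using flip(3,4) by (simp add: acyclic_orientations_iff orientation_od triangle_free_od)
  have same: "(x, y) \<in> orient n c2 \<longleftrightarrow> (x, y) \<in> ?D1" if "(x, y) \<noteq> (i, k)" "(x, y) \<noteq> (k, i)" for x y
    using c2(7) that by (cases ?w) auto
  have restr2: "restr (orient n c2) (k - 1) = restr ?D1 (k - 1)"
  proof -
    have "(x, y) \<in> restr (orient n c2) (k - 1) \<longleftrightarrow> (x, y) \<in> restr ?D1 (k - 1)" for x y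
      using same[of x y] k by (cases "x = k \<or> y = k") (auto simp: restr_def)
    then show ?thesis by auto
  qed
  have sel2: "sel c2 j = j" if "k < j" "j \<le> n" for j
    using c2(8) c1(7)[of j] that by (auto split: if_splits)
  have swept2: "swept c2 j" if j: "k < j" "j \<le> n" for j
  proof -
    have "ptr c2 j = ptr c1 j" "dir c2 j = dir c1 j" using c2(8) j by (auto split: if_splits)
    moreover have "(x, j) \<in> od w (orient n c2) \<longleftrightarrow> (x, j) \<in> od w ?D1" for x w
      using same[of x j] same[of j x] i j by (cases w) auto
    ultimately show ?thesis using c1(4)[OF j] by (simp add: swept_def)
  qed
  \<comment> \<open>At the end of its sweep \<open>k\<close> inherits the return address of level
    \<open>k - 1\<close>.\<close>
  have sel_k: "sel c2 k = (if Suc t = ?d then sel c0 (k - 1) else k)"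
    using c2(8) c1(7)[of k] c1(8)[of "k - 1"] c(9) k by (auto split: if_splits)
  have sel_lt: "sel c2 j = (if Suc t = ?d \<and> j = k - 1 then k - 1 else sel c0 j)" if "j < k" for j
    using c2(8) c1(8)[OF that] c(9) k that by (auto split: if_splits)
  have unch: "unchanged j c0 c2" if "j < k" for j
  proof -
    have "unchanged j c0 c" "unchanged j c c1" using c(10) c1(5) that by auto
    moreover have "ptr c2 j = ptr c1 j" "dir c2 j = dir c1 j"
      using c2(8) that by (auto split: if_splits)
    ultimately show ?thesis using c2(4)[of j] that by (auto simp: unchanged_def)
  qed
  have ord2: "lists_order E k (\<lambda>q. ordT c2 (k, q)) (od ?w (orient n c2))"
    by (rule lists_order_cong[OF _ c2(5)]) (auto simp: c2(7) nbrs_iff)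
  \<comment> \<open>The new visit is worth \<open>b + 19\<close>: 19 for the constant cost of the
    round and \<open>b\<close> for the growth of \<open>b * t\<close>. The sort at
    \<open>t = 0\<close> is covered by \<open>b * d\<close>, which enters with the first
    flip.\<close>
  have clk: "clock c2 + (b + 19) * length (visits c0) + b * Suc t
       \<le> clock c0 + (b + 19) * length (visits c2) + b * ?d"
    using c2(2,3) c1(9) c(11) b by (auto simp: algebra_simps split: if_splits)
  have "step\<^sup>*\<^sup>* c0 c2"
    using c(1) c1(1) c2(1) by (meson step_def rtranclp.rtrancl_into_rtrancl rtranclp_trans)
  moreover have "fresh k c2" using AO2 sel2 swept2 by (simp add: fresh_def)
  moreover have "ptr c2 k = (if Suc t = ?d then 0 else Suc t)"
    "dir c2 k = (if Suc t = ?d then opp ?w else ?w)"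
    using c2(8) k1 by (auto split: if_splits)
  moreover have "restr (orient n c2) (k - 1) = restr (orient n c0) (k - 1)"
    using restr2 restr_pred[OF c1(3)] c(3) by simp
  ultimately have "sweeping b k c0 (Suc t) c2"
    using flip(5) sel_k sel_lt unch ord2 clk enumeration_extend[OF k sw seg] c2(2)
    unfolding sweeping_def Let_def by simp
  then show ?thesis ..
qed

lemma sweeping_exists:
  assumes k: "2 \<le> k" "k \<le> n" and fresh: "fresh (k - 1) c0" and t: "t \<le> card (nbrs E k)"
    and IH: "\<And>c. fresh k c \<Longrightarrow> \<exists>c'. segment (b + 19) k c c'"
    and l: "card (nbrs E k) \<le> 2 ^ l" and b: "b = 4 * (l + 2)"
  shows "\<exists>c. sweeping b k c0 t c"
  using t
proof (induction t)
  case 0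
  then show ?case using sweeping_0[OF k fresh] by blast
next
  case (Suc t)
  then obtain c where c: "sweeping b k c0 t c" by auto
  then have "fresh k c" by (auto simp: sweeping_def Let_def)
  then obtain c1 where "segment (b + 19) k c c1" using IH by blast
  then show ?case using sweeping_Suc[OF k c _ _ l b] Suc.prems by auto
qed

text \<open>After the last flip one segment with full out-degree \<open>d\<close> remains. The terms
  \<open>b * d\<close> then cancel, and \<open>k\<close> is ready to sweep in the opposite
  direction.\<close>

lemma segment_pred:
  assumes k: "2 \<le> k" "k \<le> n" and sw: "sweeping b k c0 (card (nbrs E k)) c"
    and seg: "segment (b + 19) k c c'"
  shows "segment (b + 19) (k - 1) c0 c'"
proof -
  let ?d = "card (nbrs E k)" and ?w = "dir c0 k"
  have c: "step\<^sup>*\<^sup>* c0 c" "restr (orient n c) (k - 1) = restr (orient n c0) (k - 1)"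
    "card (outs E k (od ?w (orient n c))) = ?d" "ptr c k = 0" "dir c k = opp ?w"
    "sel c k = sel c0 (k - 1)" "\<forall>j<k. sel c j = (if j = k - 1 then k - 1 else sel c0 j)"
    "\<forall>j<k. unchanged j c0 c"
    "clock c + (b + 19) * length (visits c0) + b * ?d
       \<le> clock c0 + (b + 19) * length (visits c) + b * ?d"
    using sw nbrs_nonempty[OF k] by (auto simp: sweeping_def Let_def)
  have c': "step\<^sup>*\<^sup>* c c'" "orient n c' \<in> acyclic_orientations E"
     "restr (orient n c') k = restr (orient n c) k" "\<And>j. k < j \<Longrightarrow> j \<le> n \<Longrightarrow> swept c' j"
     "\<forall>j\<le>k. unchanged j c c'" "sel c' n = sel c k"
     "\<And>j. k \<le> j \<Longrightarrow> j < n \<Longrightarrow> sel c' j = j" "\<And>j. j < k \<Longrightarrow> sel c' j = sel c j"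
     "clock c' + (b + 19) * length (visits c) \<le> clock c + (b + 19) * length (visits c')"
    using seg by (auto simp: segment_def)
  have "outs E k (od ?w (orient n c')) = nbrs E k"
  proof (rule card_subset_eq)
    show "card (outs E k (od ?w (orient n c'))) = ?d"
      using outs_cong_restr[OF c'(3), of ?w] c(3) by simp
  qed (auto simp: outs_def)
  then have "swept c' k"
    using c'(5) c(4,5) by (auto simp: swept_def unchanged_def od_opp outs_def)
  then have swept': "swept c' j" if "k - 1 < j" "j \<le> n" for j
    using c'(4)[of j] that by (cases "j = k") auto
  \<comment> \<open>No out-degree exceeds \<open>d\<close>, so this condition drops out of the
    enumerated set.\<close>
  have "card (outs E k A) < Suc ?d" for A
    by (simp add: less_Suc_eq_le card_mono outs_def)
  then have enum: "\<exists>vs. visits c' @ [orient n c'] = visits c0 @ vs \<and> distinct vs \<and>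
     set vs = {D \<in> acyclic_orientations E. restr D (k - 1) = restr (orient n c0) (k - 1)}"
    using enumeration_extend[OF k sw seg] by simp
  have sel': "sel c' j = j" if "k - 1 \<le> j" "j < n" for j
    using c'(7)[of j] c'(8)[of j] c(7) that k by (cases "j = k - 1") auto
  have unch: "unchanged j c0 c'" if "j \<le> k - 1" for j
    using c(8) c'(5) that k by (auto simp: unchanged_def)
  have "step\<^sup>*\<^sup>* c0 c'" using c(1) c'(1) by simp
  then show ?thesis
    using c'(2,6,8,9) restr_pred[OF c'(3)] c(2,6,7,9) swept' sel' unch enum
    unfolding segment_def by auto
qed

text \<open>At \<open>k = n\<close> the segment has no rounds, since an orientation is its own
  restriction to \<open>[n]\<close>. A segment of level \<open>k\<close> alternates segments of
  level \<open>Suc k\<close> with flips at \<open>Suc k\<close>.\<close>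

lemma segment_exists:
  assumes "1 \<le> k" "k \<le> n" "fresh k c"
    and l: "clique_number n E \<le> 2 ^ l" and b: "b = 4 * (l + 2)"
  shows "\<exists>c'. segment (b + 19) k c c'"
  using assms(2,1,3)
proof (induction arbitrary: c rule: inc_induct)
  case base
  have full: "restr D n = D" if "D \<in> acyclic_orientations E" for D
    using that orientation_E E_range by (fastforce simp: restr_def acyclic_orientations_iff)
  have "{D \<in> acyclic_orientations E. restr D n = restr (orient n c) n} = {orient n c}"
    using base.prems(2) full by (auto simp: fresh_def)
  then have "segment (b + 19) n c c"
    using base.prems by (auto simp: segment_def fresh_def unchanged_def)
  then show ?case ..
next
  case (step k)
  have k: "2 \<le> Suc k" "Suc k \<le> n" using step by auto
  have l': "card (nbrs E (Suc k)) \<le> 2 ^ l"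
    using card_nbrs_le[of "Suc k"] k l by auto
  have IH: "\<exists>c'. segment (b + 19) (Suc k) c c'" if "fresh (Suc k) c" for c
    using step.IH that by simp
  obtain c1 where c1: "sweeping b (Suc k) c (card (nbrs E (Suc k))) c1"
    using sweeping_exists[OF k _ order_refl IH l' b, of c] step.prems by auto
  then have "fresh (Suc k) c1" by (auto simp: sweeping_def Let_def)
  then obtain c2 where "segment (b + 19) (Suc k) c1 c2" using IH by blast
  from segment_pred[OF k c1 this] show ?case by auto
qed

section \<open>From segments to a complete run\<close>

lemma rounds_if_steps: "step\<^sup>*\<^sup>* c c' \<Longrightarrow> rounds n E c' c'' \<Longrightarrow> rounds n E c c''"
  by (induction rule: converse_rtranclp_induct) (auto simp: step_def intro: rounds.continue)

text \<open>Initially arcs go from smaller to larger vertices, so each \<open>j\<close> is a sink of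
  \<open>D_j\<close>, as direction \<open>L\<close> demands.\<close>

lemma fresh_initial: "fresh k (initial n E)"
proof -
  have D: "orient n (initial n E) = {(i, j) \<in> E. i < j}"
  proof -
    have "(x, y) \<in> orient n (initial n E) \<longleftrightarrow> (x, y) \<in> E \<and> x < y" for x y
      using E_range[of x y] by (auto simp: orient_iff initial_def nbrs_iff)
    then show ?thesis by auto
  qed
  have "orient n (initial n E) \<in> acyclic_orientations E"
    unfolding acyclic_orientations_iff orientation_def triangle_free_def D
    using E_range by (auto, meson nat_neq_iff)
  moreover have "swept (initial n E) j" for j
    unfolding swept_def D by (auto simp: nbrs_iff initial_def)
  ultimately show ?thesis by (auto simp: fresh_def initial_def)
qed

text \<open>There are no arcs within \<open>[1]\<close>, so the segment of level 1 covers all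
  acyclic orientations; it ends with \<open>s_n = 1\<close>, which halts the next round. The factor
  is \<open>4 * (l + 2) + 19\<close>.\<close>

lemma algorithm_A_correct:
  assumes l: "clique_number n E \<le> 2 ^ l"
  shows "\<exists>c. algorithm_A n E c \<and> distinct (visits c) \<and> set (visits c) = acyclic_orientations E \<and>
     visits c \<noteq> [] \<and> clock c \<le> (4 * l + 27) * length (visits c)"
proof -
  have n: "1 \<le> n" using connected by (simp add: graph_connected_def)
  let ?c = "initial n E" and ?b = "4 * (l + 2)"
  obtain c1 where seg: "segment (?b + 19) 1 ?c c1"
    using segment_exists[OF order_refl n fresh_initial l refl] by blast
  have init: "visits ?c = []" "clock ?c = 0" "sel ?c 1 = 1" by (simp_all add: initial_def)
  have 1: "step\<^sup>*\<^sup>* ?c c1" "sel c1 n = 1" "clock c1 \<le> (?b + 19) * length (visits c1)"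
    using seg init by (auto simp: segment_def)
  have "restr D 1 = {}" if "D \<in> acyclic_orientations E" for D
    using that orientation_E by (fastforce simp: restr_def acyclic_orientations_iff)
  moreover have "orient n ?c \<in> acyclic_orientations E" using fresh_initial by (simp add: fresh_def)
  ultimately have vs: "distinct (visits c1 @ [orient n c1])"
    "set (visits c1 @ [orient n c1]) = acyclic_orientations E"
    using seg init by (auto simp: segment_def)
  \<comment> \<open>The halting round costs 2: its visit and the reading of
    \<open>s_n\<close>.\<close>
  define c where "c = c1\<lparr>visits := visits c1 @ [orient n c1], clock := clock c1 + 2\<rparr>"
  have "run_state (one_round n E) c1 = (True, c)"
    using 1(2) by (simp add: one_round_def c_def)
  then have "algorithm_A n E c"
    using rounds_if_steps[OF 1(1)] rounds.halt by (simp add: algorithm_A_def)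
  moreover have "clock c \<le> (4 * l + 27) * length (visits c)"
    using 1(3) by (simp add: c_def algebra_simps)
  ultimately show ?thesis using vs by (intro exI[of _ c]) (simp add: c_def)
qed

end

text \<open>The maximum with 1 accounts for clique number 1, where the logarithm vanishes.\<close>

theorem theorem7:
  shows "\<exists>C::real. C > 0 \<and>
    (\<forall>(n::nat) (E::(nat \<times> nat) set).
       simple_graph n E \<and> graph_connected n E \<and> chordal E \<and> perfect_elimination_order n E \<longrightarrow>
       (\<exists>c. algorithm_A n E c \<and>
            distinct (visits c) \<and>
            set (visits c) = acyclic_orientations E \<and>
            real (clock c) / real (length (visits c)) \<le> C * max 1 (log 2 (real (clique_number n E)))))"
proof (intro exI[of _ 35] conjI allI impI)
  fix n E
  assume G: "simple_graph n E \<and> graph_connected n E \<and> chordal E \<and> perfect_elimination_order n E"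
  then interpret peo_graph n E by unfold_locales auto
  let ?\<omega> = "clique_number n E"
  define l where "l = nat \<lceil>log 2 (real ?\<omega>)\<rceil>"
  have log: "0 \<le> log 2 (real ?\<omega>)" using clique_number_pos by simp
  then have l: "log 2 (real ?\<omega>) \<le> real l" "real l \<le> log 2 (real ?\<omega>) + 1"
    unfolding l_def by linarith+
  have "real ?\<omega> \<le> 2 powr real l"
    using l(1) clique_number_pos by (simp add: log_le_iff)
  then have "real ?\<omega> \<le> real (2 ^ l)" by (simp add: powr_realpow)
  then have "?\<omega> \<le> 2 ^ l" by (simp only: of_nat_le_iff)
  from algorithm_A_correct[OF this] obtain c where c: "algorithm_A n E c" "distinct (visits c)"
    "set (visits c) = acyclic_orientations E" "visits c \<noteq> []"
    "clock c \<le> (4 * l + 27) * length (visits c)" by blast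
  have "real (clock c) \<le> real (4 * l + 27) * real (length (visits c))"
    using c(5) by (metis of_nat_le_iff of_nat_mult)
  then have "real (clock c) / real (length (visits c)) \<le> real (4 * l + 27)"
    using c(4) by (simp add: divide_le_eq)
  \<comment> \<open>Rounding up costs at most 1, so \<open>4 * l + 27\<close> is at most 4 times the
    logarithm plus 31, and \<open>4 + 31 = 35\<close>.\<close>
  also have "\<dots> \<le> 35 * max 1 (log 2 (real ?\<omega>))"
    using l(2) by (simp add: max_def)
  finally show "\<exists>c. algorithm_A n E c \<and> distinct (visits c) \<and>
    set (visits c) = acyclic_orientations E \<and>
    real (clock c) / real (length (visits c)) \<le> 35 * max 1 (log 2 (real ?\<omega>))"
    using c by blast
qed simp

end
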